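(* For every integer $k\ge 0$, define the formal power series in $a$ $$\phi_k(a;x,y,t,u)=\sum_{n\ge 0}\sum_{\pi\in\mathcal{OP}_n^k}x^{(\mathrm{mak}+\mathrm{bInv})(\pi)}\,y^{\mathrm{cinvLSB}(\pi)}\,t^{\mathrm{inv}(\pi)}\,u^{\mathrm{cinv}(\pi)}\,a^{n},$$ $$\varphi_k(a;z,t,u)=\sum_{n\ge 0}\sum_{\pi\in\mathcal{OP}_n^k}z^{(\mathrm{lmak}+\mathrm{bInv})(\pi)}\,t^{\mathrm{inv}(\pi)}\,u^{\mathrm{cinv}(\pi)}\,a^{n}.$$ Then $$\phi_k(a;x,y,t,u)=\frac{a^{k}(xy)^{\binom{k}{2}}\,[k]_{tx,uy}!}{\prod_{i=1}^k\bigl(1-a[i]_{x,y}\bigr)},\qquad \varphi_k(a;z,t,u)=\frac{a^{k}z^{\binom{k}{2}}\,[k]_{tz,u}!}{\prod_{i=1}^k\bigl(1-a[i]_{z}\bigr)}.$$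
   Context: For $p,q$ variables, $[n]_{p,q}=\frac{p^n-q^n}{p-q}=\sum_{i=0}^{n-1}p^{n-1-i}q^i$, $[n]_{p,q}!=[1]_{p,q}[2]_{p,q}\cdots[n]_{p,q}$ (empty product $=1$), and $[n]_q=[n]_{1,q}$. An ordered partition of $[n]=\{1,\dots,n\}$ into $k$ blocks is a sequence $\pi=(B_1,\dots,B_k)$ of nonempty pairwise disjoint sets with union $[n]$; $\mathcal{OP}_n^k$ denotes the set of these ($\mathcal{OP}_0^0$ consists of the empty ordered partition). The opener (resp. closer) of a block is its least (resp. greatest) element; $\mathrm{open}(\pi)$, $\mathrm{clos}(\pi)$ are the sets of openers and closers. For $i\in[n]$, $\mathrm{block}(i)$ is the index $j$ with $i\in B_j$. For $i\in[n]$ define: $\mathrm{ros}_i=\#\{j\in\mathrm{open}(\pi): j<i,\ \mathrm{block}(j)>\mathrm{block}(i)\}$, $\mathrm{los}_i=\#\{j\in\mathrm{open}(\pi): j<i,\ \mathrm{block}(j)<\mathrm{block}(i)\}$, $\mathrm{rcs}_i=\#\{j\in\mathrm{clos}(\pi): j<i,\ \mathrm{block}(j)>\mathrm{block}(i)\}$, $\mathrm{lcs}_i=\#\{j\in\mathrm{clos}(\pi): j<i,\ \mathrm{block}(j)<\mathrm{block}(i)\}$, and $\mathrm{rsb}_i$ (resp. $\mathrm{lsb}_i$) is the number of blocks $B$ to the right (resp. left) of the block containing $i$ such that $\min B<i<\max B$. For each such coordinate statistic $s$, $s(\pi)=\sum_{i\in[n]}s_i(\pi)$. $\mathrm{bInv}(\pi)$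 is the number of pairs $a<b$ such that every element of $B_a$ is greater than every element of $B_b$. Let $C_1,\dots,C_k$ be the blocks of $\pi$ listed in increasing order of their minima and let $\sigma$ be the permutation of $[k]$ with $B_i=C_{\sigma(i)}$; $\mathrm{inv}(\pi)$ is the number of inversions of $\sigma$ (equivalently, the number of pairs $a<b$ with $\min B_a>\min B_b$) and $\mathrm{cinv}(\pi)=\binom{k}{2}-\mathrm{inv}(\pi)$. Finally $\mathrm{mak}=\mathrm{ros}+\mathrm{lcs}$, $\mathrm{lmak}=n(k-1)-(\mathrm{los}+\mathrm{rcs})$, and $\mathrm{cinvLSB}=\mathrm{lsb}+\mathrm{cbInv}+\binom{k}{2}$ with $\mathrm{cbInv}=\binom{k}{2}-\mathrm{bInv}$. *)

theory Defs
  imports "HOL-Computational_Algebra.Formal_Power_Series"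
begin

text \<open>
  For \<open>p \<noteq> q\<close> in a field this is \<open>(p ^ n - q ^ n) / (p - q)\<close>; the sum is also
  meaningful for \<open>p = q\<close>.
\<close>
definition pq_int :: "nat \<Rightarrow> 'a::comm_ring_1 \<Rightarrow> 'a \<Rightarrow> 'a" where
  "pq_int n p q = (\<Sum>i<n. p ^ (n - 1 - i) * q ^ i)"

definition pq_fact :: "nat \<Rightarrow> 'a::comm_ring_1 \<Rightarrow> 'a \<Rightarrow> 'a" where
  "pq_fact n p q = (\<Prod>i=1..n. pq_int i p q)"

definition q_int :: "nat \<Rightarrow> 'a::comm_ring_1 \<Rightarrow> 'a" where
  "q_int n q = pq_int n 1 q"

lemma pq_int_eq_divide:
  fixes p q :: "'a::field"
  assumes "p \<noteq> q"
  shows "pq_int n p q = (p ^ n - q ^ n) / (p - q)"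
proof -
  have "p ^ n - q ^ n = (p - q) * (\<Sum>i<n. q ^ i * p ^ (n - Suc i))"
  proof -
    have "q ^ n - p ^ n = (q - p) * (\<Sum>i<n. p ^ (n - Suc i) * q ^ i)"
      by (rule power_diff_sumr2)
    thus ?thesis by (simp add: algebra_simps)
  qed
  thus ?thesis using assms by (simp add: pq_int_def mult.commute)
qed

text \<open>
  An ordered partition is the list of its blocks. List positions start at 0, so the block
  \<open>B\<^sub>j\<close> is \<open>\<pi> ! (j - 1)\<close>; all statistics only compare positions.
\<close>
definition ordered_partitions :: "nat \<Rightarrow> nat \<Rightarrow> nat set list set" where
  "ordered_partitions n k =
     {\<pi>. length \<pi> = k \<and> (\<forall>B\<in>set \<pi>. B \<noteq> {}) \<and>
         (\<forall>i<k. \<forall>j<k. i \<noteq> j \<longrightarrow> \<pi> ! i \<inter> \<pi> ! j = {}) \<and>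
         \<Union>(set \<pi>) = {1..n}}"

definition ground :: "nat set list \<Rightarrow> nat set" where
  "ground \<pi> = \<Union>(set \<pi>)"

definition openers :: "nat set list \<Rightarrow> nat set" where
  "openers \<pi> = Min ` set \<pi>"

definition closers :: "nat set list \<Rightarrow> nat set" where
  "closers \<pi> = Max ` set \<pi>"

definition block :: "nat set list \<Rightarrow> nat \<Rightarrow> nat" where
  "block \<pi> i = (THE j. j < length \<pi> \<and> i \<in> \<pi> ! j)"

definition ros_at :: "nat set list \<Rightarrow> nat \<Rightarrow> nat" where
  "ros_at \<pi> i = card {j \<in> openers \<pi>. j < i \<and> block \<pi> j > block \<pi> i}"

definition los_at :: "nat set list \<Rightarrow> nat \<Rightarrow> nat" where
  "los_at \<pi> i = card {j \<in> openers \<pi>. j < i \<and> block \<pi> j < block \<pi> i}"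

definition rcs_at :: "nat set list \<Rightarrow> nat \<Rightarrow> nat" where
  "rcs_at \<pi> i = card {j \<in> closers \<pi>. j < i \<and> block \<pi> j > block \<pi> i}"

definition lcs_at :: "nat set list \<Rightarrow> nat \<Rightarrow> nat" where
  "lcs_at \<pi> i = card {j \<in> closers \<pi>. j < i \<and> block \<pi> j < block \<pi> i}"

definition lsb_at :: "nat set list \<Rightarrow> nat \<Rightarrow> nat" where
  "lsb_at \<pi> i = card {b. b < block \<pi> i \<and> Min (\<pi> ! b) < i \<and> i < Max (\<pi> ! b)}"

definition ros :: "nat set list \<Rightarrow> nat" where
  "ros \<pi> = (\<Sum>i\<in>ground \<pi>. ros_at \<pi> i)"

definition los :: "nat set list \<Rightarrow> nat" where
  "los \<pi> = (\<Sum>i\<in>ground \<pi>. los_at \<pi> i)"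

definition rcs :: "nat set list \<Rightarrow> nat" where
  "rcs \<pi> = (\<Sum>i\<in>ground \<pi>. rcs_at \<pi> i)"

definition lcs :: "nat set list \<Rightarrow> nat" where
  "lcs \<pi> = (\<Sum>i\<in>ground \<pi>. lcs_at \<pi> i)"

definition lsb :: "nat set list \<Rightarrow> nat" where
  "lsb \<pi> = (\<Sum>i\<in>ground \<pi>. lsb_at \<pi> i)"

definition bInv :: "nat set list \<Rightarrow> nat" where
  "bInv \<pi> = card {(a, b). a < b \<and> b < length \<pi> \<and> (\<forall>v\<in>\<pi> ! a. \<forall>w\<in>\<pi> ! b. v > w)}"

definition std_blocks :: "nat set list \<Rightarrow> nat set list" where
  "std_blocks \<pi> = sort_key Min \<pi>"

definition block_perm :: "nat set list \<Rightarrow> nat \<Rightarrow> nat" where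
  "block_perm \<pi> i = (THE j. j < length \<pi> \<and> \<pi> ! i = std_blocks \<pi> ! j)"

definition op_inv :: "nat set list \<Rightarrow> nat" where
  "op_inv \<pi> = card {(a, b). a < b \<and> b < length \<pi> \<and> block_perm \<pi> a > block_perm \<pi> b}"

text \<open>
  The subtractions below are on natural numbers. They never truncate on ordered partitions:
  see \<open>op_inv_le\<close>, \<open>bInv_le\<close> and \<open>los_rcs_le\<close>.
\<close>
definition op_cinv :: "nat set list \<Rightarrow> nat" where
  "op_cinv \<pi> = (length \<pi> choose 2) - op_inv \<pi>"

definition cbInv :: "nat set list \<Rightarrow> nat" where
  "cbInv \<pi> = (length \<pi> choose 2) - bInv \<pi>"

definition mak :: "nat set list \<Rightarrow> nat" where
  "mak \<pi> = ros \<pi> + lcs \<pi>"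

definition lmak :: "nat set list \<Rightarrow> nat" where
  "lmak \<pi> = card (ground \<pi>) * (length \<pi> - 1) - (los \<pi> + rcs \<pi>)"

definition cinvLSB :: "nat set list \<Rightarrow> nat" where
  "cinvLSB \<pi> = lsb \<pi> + cbInv \<pi> + (length \<pi> choose 2)"

text \<open>The formal variable \<open>a\<close> of the two generating functions is \<^const>\<open>fps_X\<close>.\<close>
definition phi_mak :: "nat \<Rightarrow> 'a::comm_ring_1 \<Rightarrow> 'a \<Rightarrow> 'a \<Rightarrow> 'a \<Rightarrow> 'a fps" where
  "phi_mak k x y t u = Abs_fps (\<lambda>n. \<Sum>\<pi>\<in>ordered_partitions n k.
     x ^ (mak \<pi> + bInv \<pi>) * y ^ cinvLSB \<pi> * t ^ op_inv \<pi> * u ^ op_cinv \<pi>)"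

definition phi_lmak :: "nat \<Rightarrow> 'a::comm_ring_1 \<Rightarrow> 'a \<Rightarrow> 'a \<Rightarrow> 'a fps" where
  "phi_lmak k z t u = Abs_fps (\<lambda>n. \<Sum>\<pi>\<in>ordered_partitions n k.
     z ^ (lmak \<pi> + bInv \<pi>) * t ^ op_inv \<pi> * u ^ op_cinv \<pi>)"

lemma finite_ordered_partitions: "finite (ordered_partitions n k)"
proof (rule finite_subset)
  show "ordered_partitions n k \<subseteq> {\<pi>. set \<pi> \<subseteq> Pow {1..n} \<and> length \<pi> = k}"
    by (auto simp: ordered_partitions_def)
  show "finite {\<pi>. set \<pi> \<subseteq> Pow {1..n} \<and> length \<pi> = k}"
    by (rule finite_lists_length_eq) simp
qed

lemma card_pairs_le: "card {(a, b). a < b \<and> b < k \<and> P a b} \<le> k choose 2"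
proof -
  have "{(a, b). a < b \<and> b < k \<and> P a b} \<subseteq> (SIGMA b:{..<k}. {..<b})\<inverse>"
    by auto
  hence "card {(a, b). a < b \<and> b < k \<and> P a b} \<le> card ((SIGMA b:{..<k}. {..<b})\<inverse>)"
    by (intro card_mono) auto
  also have "\<dots> = (\<Sum>b<k. b)"
    by (subst card_inverse, subst card_SigmaI) auto
  also have "\<dots> = k choose 2"
    by (induction k) (auto simp: numeral_2_eq_2)
  finally show ?thesis .
qed

lemma op_inv_le: "op_inv \<pi> \<le> length \<pi> choose 2"
  unfolding op_inv_def by (rule card_pairs_le)

lemma bInv_le: "bInv \<pi> \<le> length \<pi> choose 2"
  unfolding bInv_def by (rule card_pairs_le)

context
  fixes n k :: nat and \<pi> :: "nat set list"
  assumes \<pi>: "\<pi> \<in> ordered_partitions n k"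
begin

lemma length_op: "length \<pi> = k"
  using \<pi> by (simp add: ordered_partitions_def)

lemma ground_op: "ground \<pi> = {1..n}"
  using \<pi> by (simp add: ordered_partitions_def ground_def)

lemma block_op:
  assumes "j < k" "i \<in> \<pi> ! j"
  shows "block \<pi> i = j"
  unfolding block_def
proof (rule the_equality)
  show "j < length \<pi> \<and> i \<in> \<pi> ! j" using assms length_op by simp
  show "j' = j" if "j' < length \<pi> \<and> i \<in> \<pi> ! j'" for j'
    using that assms \<pi> by (auto simp: ordered_partitions_def)
qed

lemma nth_op:
  assumes "j < k"
  shows "finite (\<pi> ! j)" "Min (\<pi> ! j) \<in> \<pi> ! j" "Max (\<pi> ! j) \<in> \<pi> ! j"
proof -
  have mem: "\<pi> ! j \<in> set \<pi>" using assms length_op by simp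
  hence "\<pi> ! j \<subseteq> {1..n}" "\<pi> ! j \<noteq> {}"
    using \<pi> by (auto simp: ordered_partitions_def)
  moreover from this show "finite (\<pi> ! j)" using finite_subset by blast
  ultimately show "Min (\<pi> ! j) \<in> \<pi> ! j" "Max (\<pi> ! j) \<in> \<pi> ! j" by auto
qed

lemma los_rcs_at_le:
  assumes "i \<in> {1..n}"
  shows "los_at \<pi> i + rcs_at \<pi> i \<le> k - 1"
proof -
  let ?L = "{j \<in> openers \<pi>. j < i \<and> block \<pi> j < block \<pi> i}"
  let ?R = "{j \<in> closers \<pi>. j < i \<and> block \<pi> j > block \<pi> i}"
  have "i \<in> \<Union>(set \<pi>)" using assms \<pi> by (simp add: ordered_partitions_def)
  then obtain b where b: "b < k" "i \<in> \<pi> ! b"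
    using length_op by (auto simp: in_set_conv_nth)
  hence bi: "block \<pi> i = b" by (rule block_op)
  have "?L \<subseteq> (\<lambda>j. Min (\<pi> ! j)) ` {..<b}"
    unfolding openers_def bi
    using length_op nth_op(2) block_op by (force simp: in_set_conv_nth)
  hence L: "card ?L \<le> b"
    using surj_card_le[of "{..<b}" ?L] by auto
  have "?R \<subseteq> (\<lambda>j. Max (\<pi> ! j)) ` {b<..<k}"
    unfolding closers_def bi
    using length_op nth_op(3) block_op by (force simp: in_set_conv_nth)
  hence "card ?R \<le> k - Suc b"
    using surj_card_le[of "{b<..<k}" ?R] by auto
  with L b(1) show ?thesis unfolding los_at_def rcs_at_def by linarith
qed

lemma los_rcs_le: "los \<pi> + rcs \<pi> \<le> card (ground \<pi>) * (length \<pi> - 1)"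
proof -
  have "los \<pi> + rcs \<pi> = (\<Sum>i\<in>{1..n}. los_at \<pi> i + rcs_at \<pi> i)"
    by (simp add: los_def rcs_def ground_op sum.distrib)
  also have "\<dots> \<le> (\<Sum>i\<in>{1..n}. k - 1)"
    by (intro sum_mono los_rcs_at_le)
  finally show ?thesis by (simp add: ground_op length_op)
qed

lemma Min_inj_op:
  assumes "a < k" "b < k" "Min (\<pi> ! a) = Min (\<pi> ! b)"
  shows "a = b"
  using assms nth_op(2) block_op by metis

lemma op_inv_eq:
  "op_inv \<pi> = card {(a, b). a < b \<and> b < k \<and> Min (\<pi> ! a) > Min (\<pi> ! b)}"
proof -
  let ?C = "std_blocks \<pi>"
  have len: "length ?C = k" by (simp add: std_blocks_def length_op)
  have dm: "distinct (map Min \<pi>)"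
    using Min_inj_op length_op by (auto simp: distinct_conv_nth)
  have "mset (map Min ?C) = mset (map Min \<pi>)" by (simp add: std_blocks_def)
  hence dC: "distinct (map Min ?C)" using dm mset_eq_imp_distinct_iff by blast
  have "sorted (map Min ?C)" by (simp add: std_blocks_def)
  hence st: "sorted_wrt (<) (map Min ?C)" using dC by (simp add: strict_sorted_iff)
  have mono: "Min (?C ! i) < Min (?C ! j)" if "i < j" "j < k" for i j
    using sorted_wrt_nth_less[OF st that(1)] that len by simp
  have perm: "block_perm \<pi> a < k \<and> \<pi> ! a = ?C ! block_perm \<pi> a" if "a < k" for a
  proof -
    have "\<pi> ! a \<in> set ?C" using that length_op by (simp add: std_blocks_def)
    then obtain j where j: "j < k" "\<pi> ! a = ?C ! j" using len by (metis in_set_conv_nth)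
    have "block_perm \<pi> a = j" unfolding block_perm_def
    proof (rule the_equality)
      show "j < length \<pi> \<and> \<pi> ! a = ?C ! j" using j length_op by simp
      show "j' = j" if "j' < length \<pi> \<and> \<pi> ! a = ?C ! j'" for j'
        using that j length_op mono by (metis less_irrefl linorder_neqE_nat)
    qed
    with j show ?thesis by simp
  qed
  have "block_perm \<pi> a > block_perm \<pi> b \<longleftrightarrow> Min (\<pi> ! a) > Min (\<pi> ! b)"
    if "a < k" "b < k" for a b
    using perm[OF that(1)] perm[OF that(2)] mono
    by (metis less_asym less_irrefl linorder_neqE_nat)
  hence "{(a, b). a < b \<and> b < length \<pi> \<and> block_perm \<pi> a > block_perm \<pi> b} =
         {(a, b). a < b \<and> b < k \<and> Min (\<pi> ! a) > Min (\<pi> ! b)}"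
    using length_op by auto
  thus ?thesis by (simp add: op_inv_def)
qed

end

end

theory Submission
  imports Defs
begin

text \<open>
  Insert the elements \<open>1, \<dots>, n\<close> one after the other, remembering which of the blocks opened so far are
  still active. All the statistics are sums over pairs of blocks, and the total weight of all ways to
  insert the next element depends only on the number \<open>N\<close> of blocks and the number \<open>m\<close> of active ones: adding it
  to an active block contributes a power times \<open>[m]\<^bsub>x,y\<^esub>\<close>, opening a block contributes a power times
  \<open>[N + 1]\<^bsub>tx,uy\<^esub>\<close>. What remains is a weighted count of lattice paths ending in \<open>m = 0\<close>.

  Let \<open>w\<close> mark active blocks. For mak, adding an element to an active block is a \<open>q\<close>-derivative followed by
  multiplication with \<open>1 + w\<close>, and opening a block is a \<open>q\<close>-shift followed by the same multiplication. Both
  preserve the products \<open>\<Prod>\<^bsub>i<N\<^esub> (1 + q\<^sup>-\<^sup>i w)\<close>, \<open>q = x/y\<close>: the former acts on them by the scalar \<open>[N]\<^bsub>x,y\<^esub>\<close>, the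
  latter increases \<open>N\<close>. For lmak no such invariant family of polynomials is available, but the dual
  computation works: pulling evaluation at \<open>w = 0\<close> back through the path gives functionals whose values on
  \<open>w\<^sup>m\<close> are explicit products, because \<open>[j + m] = [j] + z\<^sup>j [m]\<close>.
\<close>

section \<open>Partial partitions and insertion of the maximum\<close>

text \<open>Disjointness as \<open>sorted_wrt\<close> splits along \<open>@\<close> and
  \<open>#\<close>, which suits insertion into the middle of a list.\<close>

lemma ordered_partitions_altdef:
  "ordered_partitions n k =
     {\<pi>. length \<pi> = k \<and> {} \<notin> set \<pi> \<and> sorted_wrt disjnt \<pi> \<and> \<Union>(set \<pi>) = {1..n}}"
proof -
  have "(\<forall>i<length \<pi>. \<forall>j<length \<pi>. i \<noteq> j \<longrightarrow> \<pi> ! i \<inter> \<pi> ! j = {}) \<longleftrightarrow> sorted_wrt disjnt \<pi>"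
    for \<pi> :: "nat set list"
  proof
    assume R: "sorted_wrt disjnt \<pi>"
    show "\<forall>i<length \<pi>. \<forall>j<length \<pi>. i \<noteq> j \<longrightarrow> \<pi> ! i \<inter> \<pi> ! j = {}"
    proof (intro allI impI)
      fix i j assume "i < length \<pi>" "j < length \<pi>" "i \<noteq> j"
      thus "\<pi> ! i \<inter> \<pi> ! j = {}"
        using R by (cases i j rule: linorder_cases) (auto simp: sorted_wrt_iff_nth_less disjnt_def)
    qed
  qed (auto simp: sorted_wrt_iff_nth_less disjnt_def)
  thus ?thesis unfolding ordered_partitions_def by auto
qed

text \<open>
  The flag of a block is \<^term>\<open>True\<close> while the block is active, i.e. while it is still going to
  receive an element larger than \<open>n\<close>.
\<close>
definition partial_partitions :: "nat \<Rightarrow> nat \<Rightarrow> nat \<Rightarrow> (nat set \<times> bool) list set" where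
  "partial_partitions n N m =
     {xs. map fst xs \<in> ordered_partitions n N \<and> length (filter snd xs) = m}"

lemma partial_partitions_altdef:
  "partial_partitions n N m =
     {xs. length xs = N \<and> {} \<notin> fst ` set xs \<and> sorted_wrt (\<lambda>p q. disjnt (fst p) (fst q)) xs \<and>
          \<Union>(fst ` set xs) = {1..n} \<and> length (filter snd xs) = m}"
  by (auto simp: partial_partitions_def ordered_partitions_altdef sorted_wrt_map)

lemma finite_partial_partitions: "finite (partial_partitions n N m)"
proof (rule finite_subset)
  show "partial_partitions n N m \<subseteq> {xs. set xs \<subseteq> Pow {1..n} \<times> UNIV \<and> length xs = N}"
    by (fastforce simp: partial_partitions_altdef)
  show "finite {xs :: (nat set \<times> bool) list. set xs \<subseteq> Pow {1..n} \<times> UNIV \<and> length xs = N}"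
    by (rule finite_lists_length_eq) simp
qed

lemma partial_partitions_empty: "N < m \<Longrightarrow> partial_partitions n N m = {}"
proof (rule ccontr)
  assume "N < m" "partial_partitions n N m \<noteq> {}"
  then obtain xs :: "(nat set \<times> bool) list" where "length xs = N" "length (filter snd xs) = m"
    by (auto simp: partial_partitions_altdef)
  with \<open>N < m\<close> show False using length_filter_le[of snd xs] by simp
qed

lemma partial_partitions_mem:
  assumes "xs \<in> partial_partitions n N m" "p \<in> set xs"
  shows "finite (fst p)" "fst p \<noteq> {}" "\<forall>i\<in>fst p. i < Suc n"
proof -
  have "fst p \<subseteq> {1..n}" "fst p \<noteq> {}" using assms by (auto simp: partial_partitions_altdef)
  thus "finite (fst p)" "fst p \<noteq> {}" "\<forall>i\<in>fst p. i < Suc n"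
    by (auto intro: finite_subset)
qed

text \<open>State and position form one argument so that sums can be reindexed along an injective
  map. The flag \<open>g\<close> tells whether the block is still active after receiving
  \<open>v\<close>.\<close>

definition grow :: "nat \<Rightarrow> bool \<Rightarrow> (nat set \<times> bool) list \<times> nat \<Rightarrow> (nat set \<times> bool) list" where
  "grow v g = (\<lambda>(xs, j). take j xs @ (insert v (fst (xs ! j)), g) # drop (Suc j) xs)"

definition open_block :: "nat \<Rightarrow> bool \<Rightarrow> (nat set \<times> bool) list \<times> nat \<Rightarrow> (nat set \<times> bool) list" where
  "open_block v g = (\<lambda>(xs, l). take l xs @ ({v}, g) # drop l xs)"

definition grow_dom :: "nat \<Rightarrow> nat \<Rightarrow> nat \<Rightarrow> ((nat set \<times> bool) list \<times> nat) set" where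
  "grow_dom n N m = (SIGMA xs : partial_partitions n N m. {j. j < length xs \<and> snd (xs ! j)})"

text \<open>With \<open>P\<close> saying that a block contains the new maximum, this reads the place
  of insertion off the resulting list.\<close>

lemma split_unique:
  assumes "ys @ p # zs = ys' @ p' # zs'" "P p" "P p'"
    "\<forall>q\<in>set ys \<union> set zs \<union> set ys' \<union> set zs'. \<not> P q"
  shows "ys = ys'" "p = p'" "zs = zs'"
proof -
  have "ys = ys' \<and> p = p' \<and> zs = zs'"
    using assms
  proof (induction ys arbitrary: ys')
    case Nil
    thus ?case by (cases ys') auto
  next
    case (Cons a ys)
    thus ?case by (cases ys') auto
  qed
  thus "ys = ys'" "p = p'" "zs = zs'" by auto
qed

lemma notin_blocks:
  assumes "xs \<in> partial_partitions n N m" "q \<in> set xs"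
  shows "Suc n \<notin> fst q"
  using partial_partitions_mem(3)[OF assms] by auto

text \<open>The block of \<open>Suc n\<close> reveals the position, deleting \<open>Suc n\<close>
  restores the content, and the old flag was \<open>True\<close> by the choice of
  \<open>grow_dom\<close>.\<close>

lemma inj_on_grow: "inj_on (grow (Suc n) g) (grow_dom n N m)"
proof (rule inj_onI, clarify)
  fix xs j xs' j'
  assume a: "(xs, j) \<in> grow_dom n N m" "(xs', j') \<in> grow_dom n N m"
    and eq: "grow (Suc n) g (xs, j) = grow (Suc n) g (xs', j')"
  have xs: "xs \<in> partial_partitions n N m" "j < length xs" "snd (xs ! j)"
    and xs': "xs' \<in> partial_partitions n N m" "j' < length xs'" "snd (xs' ! j')"
    using a by (auto simp: grow_dom_def)
  have nin: "\<forall>q\<in>set xs \<union> set xs'. Suc n \<notin> fst q" using notin_blocks xs(1) xs'(1) by blast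
  have "\<forall>q\<in>set (take j xs) \<union> set (drop (Suc j) xs) \<union> set (take j' xs') \<union> set (drop (Suc j') xs').
         \<not> Suc n \<in> fst q"
    using nin by (auto dest: in_set_takeD in_set_dropD)
  from split_unique[OF _ _ _ this, of "(insert (Suc n) (fst (xs ! j)), g)" "(insert (Suc n) (fst (xs' ! j')), g)"] eq
  have 1: "take j xs = take j' xs'" "drop (Suc j) xs = drop (Suc j') xs'"
    and 2: "insert (Suc n) (fst (xs ! j)) = insert (Suc n) (fst (xs' ! j'))"
    by (auto simp: grow_def)
  have "Suc n \<notin> fst (xs ! j)" "Suc n \<notin> fst (xs' ! j')"
    using nin xs(2) xs'(2) by auto
  hence "fst (xs ! j) = fst (xs' ! j')" using 2 insert_ident by metis
  hence "xs ! j = xs' ! j'" using xs(3) xs'(3) by (simp add: prod_eq_iff)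
  hence "take j xs @ xs ! j # drop (Suc j) xs = take j' xs' @ xs' ! j' # drop (Suc j') xs'"
    using 1 by simp
  hence "xs = xs'" using id_take_nth_drop xs(2) xs'(2) by metis
  moreover have "j = j'" using arg_cong[OF 1(1), of length] xs(2) xs'(2) by simp
  ultimately show "xs = xs' \<and> j = j'" by simp
qed

lemma inj_on_open_block:
  "inj_on (open_block (Suc n) g) (partial_partitions n N m \<times> {..N})"
proof (rule inj_onI, clarify)
  fix xs j xs' j'
  assume xs: "xs \<in> partial_partitions n N m" "j \<le> N" 
    and xs': "xs' \<in> partial_partitions n N m" "j' \<le> N"
    and eq: "open_block (Suc n) g (xs, j) = open_block (Suc n) g (xs', j')"
  have nin: "\<forall>q\<in>set xs \<union> set xs'. Suc n \<notin> fst q" using notin_blocks xs(1) xs'(1) by blast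
  have len: "length xs = N" "length xs' = N" using xs xs' by (auto simp: partial_partitions_altdef)
  have "\<forall>q\<in>set (take j xs) \<union> set (drop j xs) \<union> set (take j' xs') \<union> set (drop j' xs').
         \<not> Suc n \<in> fst q"
    using nin by (auto dest: in_set_takeD in_set_dropD)
  from split_unique[OF _ _ _ this, of "({Suc n}, g)" "({Suc n}, g)"] eq
  have 1: "take j xs = take j' xs'" "drop j xs = drop j' xs'"
    by (auto simp: open_block_def)
  have "xs = xs'" using 1 append_take_drop_id by metis
  moreover have "j = j'" using arg_cong[OF 1(1), of length] xs(2) xs'(2) len by simp
  ultimately show "xs = xs' \<and> j = j'" by simp
qed

text \<open>Separates the conditions on \<open>ys @ zs\<close> alone, which an insertion preserves,
  from those involving \<open>p\<close>.\<close>

lemma partial_partitions_split: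
  "ys @ p # zs \<in> partial_partitions n N m \<longleftrightarrow>
     Suc (length ys + length zs) = N \<and> fst p \<noteq> {} \<and> {} \<notin> fst ` set (ys @ zs) \<and>
     sorted_wrt (\<lambda>p q. disjnt (fst p) (fst q)) (ys @ zs) \<and>
     (\<forall>q\<in>set (ys @ zs). disjnt (fst p) (fst q)) \<and>
     fst p \<union> \<Union>(fst ` set (ys @ zs)) = {1..n} \<and>
     of_bool (snd p) + length (filter snd (ys @ zs)) = m"
proof -
  have "(\<forall>q\<in>set ys. disjnt (fst q) (fst p)) = (\<forall>q\<in>set ys. disjnt (fst p) (fst q))"
    by (auto simp: disjnt_def)
  moreover have "fst p \<union> \<Union>(fst ` set (ys @ zs)) = \<Union>(fst ` set (ys @ p # zs))" by auto
  ultimately show ?thesis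
    unfolding partial_partitions_altdef mem_Collect_eq by (simp add: sorted_wrt_append) blast
qed

lemma grow_mem:
  assumes "(xs, j) \<in> grow_dom n N m"
  shows "grow (Suc n) g (xs, j) \<in> partial_partitions (Suc n) N (m - 1 + of_bool g)"
proof -
  have xs: "xs \<in> partial_partitions n N m" "j < length xs" "snd (xs ! j)"
    using assms by (auto simp: grow_dom_def)
  let ?ys = "take j xs" and ?zs = "drop (Suc j) xs"
  have s: "?ys @ xs ! j # ?zs \<in> partial_partitions n N m" using xs id_take_nth_drop by metis
  have "\<forall>q\<in>set (?ys @ ?zs). Suc n \<notin> fst q"
    using notin_blocks[OF s] by auto
  moreover have "insert (Suc n) {1..n} = {1..Suc n}" by auto
  ultimately show ?thesis
    using s xs(3) unfolding grow_def partial_partitions_split prod.case by auto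
qed

lemma open_block_mem:
  assumes "xs \<in> partial_partitions n N m"
  shows "open_block (Suc n) g (xs, l) \<in> partial_partitions (Suc n) (Suc N) (m + of_bool g)"
proof -
  have "{1..Suc n} = insert (Suc n) {1..n}" by auto
  with assms notin_blocks[OF assms] show ?thesis
    unfolding open_block_def partial_partitions_split prod.case append_take_drop_id
    by (auto simp: partial_partitions_altdef disjnt_def)
qed

text \<open>Deleting \<open>Suc n\<close> undoes the last insertion: a singleton block has just been
  opened, any other block has grown.\<close>

lemma partial_partitions_Suc_cases:
  assumes "xs \<in> partial_partitions (Suc n) (Suc N) m"
  shows "xs \<in> grow (Suc n) False ` grow_dom n (Suc N) (Suc m) \<or>
         xs \<in> grow (Suc n) True ` grow_dom n (Suc N) m \<or>
         xs \<in> open_block (Suc n) False ` (partial_partitions n N m \<times> {..N}) \<or>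
         0 < m \<and> xs \<in> open_block (Suc n) True ` (partial_partitions n N (m - 1) \<times> {..N})"
proof -
  have "Suc n \<in> \<Union>(fst ` set xs)" using assms by (auto simp: partial_partitions_altdef)
  then obtain p where p: "p \<in> set xs" "Suc n \<in> fst p" by blast
  then obtain ys zs where xs: "xs = ys @ p # zs" by (meson split_list)
  obtain B g where pB: "p = (B, g)" by (cases p)
  have s: "ys @ p # zs \<in> partial_partitions (Suc n) (Suc N) m" using assms xs by simp
  have nin: "\<forall>q\<in>set (ys @ zs). Suc n \<notin> fst q"
    using s p(2) unfolding partial_partitions_split disjnt_def by blast
  have un: "{1..Suc n} - {Suc n} = {1..n}" by auto
  have un2: "(B - {Suc n}) \<union> \<Union>(fst ` set (ys @ zs)) = {1..n}"
  proof -
    have "B \<union> \<Union>(fst ` set (ys @ zs)) = {1..Suc n}" using s pB unfolding partial_partitions_split by simp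
    hence "(B \<union> \<Union>(fst ` set (ys @ zs))) - {Suc n} = {1..n}" using un by simp
    moreover have "Suc n \<notin> \<Union>(fst ` set (ys @ zs))" using nin by blast
    ultimately show ?thesis by blast
  qed
  show ?thesis
  proof (cases "B = {Suc n}")
    case True
    have "ys @ zs \<in> partial_partitions n N (m - of_bool g)"
      using s un2 pB True unfolding partial_partitions_split
      by (auto simp: partial_partitions_altdef)
    moreover have "length ys \<le> N" "of_bool g \<le> m" using s pB unfolding partial_partitions_split by auto
    moreover have "xs = open_block (Suc n) g (ys @ zs, length ys)"
      by (simp add: open_block_def xs pB True)
    ultimately show ?thesis by (cases g) auto
  next
    case False
    let ?B = "B - {Suc n}"
    \<comment> \<open>The shortened block is active since it is going to receive
      \<open>Suc n\<close>; in the count of active blocks, \<open>True\<close> replaces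
      \<open>g\<close>.\<close>
    have "ys @ (?B, True) # zs \<in> partial_partitions n (Suc N) (Suc m - of_bool g)"
      using s un2 pB False p(2) unfolding partial_partitions_split
      by (auto simp: disjnt_def)
    hence "(ys @ (?B, True) # zs, length ys) \<in> grow_dom n (Suc N) (Suc m - of_bool g)"
      by (simp add: grow_dom_def)
    moreover have "xs = grow (Suc n) g (ys @ (?B, True) # zs, length ys)"
      using p(2) pB by (auto simp: grow_def xs insert_absorb)
    ultimately show ?thesis by (cases g) auto
  qed
qed

text \<open>Whether the block of \<open>Suc n\<close> is active and whether it is a singleton: these
  two properties tell the four kinds of insertion apart.\<close>

lemma grow_new_block:
  assumes "c \<in> grow_dom n N m"
  shows "(\<exists>p\<in>set (grow (Suc n) g c). Suc n \<in> fst p \<and> snd p) \<longleftrightarrow> g"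
    and "{Suc n} \<notin> fst ` set (grow (Suc n) g c)"
proof -
  obtain xs j where c: "c = (xs, j)" by (cases c)
  have xs: "xs \<in> partial_partitions n N m" "j < length xs" using assms by (auto simp: grow_dom_def c)
  have nin: "\<And>q. q \<in> set xs \<Longrightarrow> Suc n \<notin> fst q" using notin_blocks[OF xs(1)] .
  have ne: "fst (xs ! j) \<noteq> {}" "Suc n \<notin> fst (xs ! j)"
    using partial_partitions_mem(2)[OF xs(1)] nin xs(2) by auto
  show "(\<exists>p\<in>set (grow (Suc n) g c). Suc n \<in> fst p \<and> snd p) \<longleftrightarrow> g"
    using nin by (auto simp: grow_def c dest: in_set_takeD in_set_dropD)
  have "insert (Suc n) (fst (xs ! j)) \<noteq> {Suc n}" using ne by blast
  thus "{Suc n} \<notin> fst ` set (grow (Suc n) g c)"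
    using nin by (force simp: grow_def c dest: in_set_takeD in_set_dropD)
qed

lemma open_block_new_block:
  assumes "c \<in> partial_partitions n N m \<times> L"
  shows "(\<exists>p\<in>set (open_block (Suc n) g c). Suc n \<in> fst p \<and> snd p) \<longleftrightarrow> g"
    and "{Suc n} \<in> fst ` set (open_block (Suc n) g c)"
proof -
  obtain xs l where c: "c = (xs, l)" by (cases c)
  have xs: "xs \<in> partial_partitions n N m" using assms by (auto simp: c)
  have nin: "\<And>q. q \<in> set xs \<Longrightarrow> Suc n \<notin> fst q" using notin_blocks[OF xs(1)] .
  show "(\<exists>p\<in>set (open_block (Suc n) g c). Suc n \<in> fst p \<and> snd p) \<longleftrightarrow> g"
    using nin by (auto simp: open_block_def c dest: in_set_takeD in_set_dropD)
  show "{Suc n} \<in> fst ` set (open_block (Suc n) g c)"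
    by (force simp: open_block_def c)
qed

lemma disjoint_if_separated:
  assumes "\<forall>x\<in>A. \<not> P x \<and> \<not> Q x" "\<forall>x\<in>B. P x \<and> \<not> Q x"
    "\<forall>x\<in>C. \<not> P x \<and> Q x" "\<forall>x\<in>D. P x \<and> Q x"
  shows "A \<inter> B = {} \<and> (A \<union> B) \<inter> C = {} \<and> (A \<union> B \<union> C) \<inter> D = {}"
  using assms by blast

text \<open>Insertion makes two binary choices: old or new block, closed or active afterwards. A new
  active block forces \<open>m > 0\<close>, hence the separate value at \<open>m = 0\<close>, where
  \<open>m - 1\<close> would truncate.\<close>

lemma sum_partial_partitions_Suc:
  fixes F :: "(nat set \<times> bool) list \<Rightarrow> 'a::comm_monoid_add"
  shows "sum F (partial_partitions (Suc n) (Suc N) m) =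
    (\<Sum>c\<in>grow_dom n (Suc N) (Suc m). F (grow (Suc n) False c)) +
    (\<Sum>c\<in>grow_dom n (Suc N) m. F (grow (Suc n) True c)) +
    (\<Sum>c\<in>partial_partitions n N m \<times> {..N}. F (open_block (Suc n) False c)) +
    (if m = 0 then 0
     else \<Sum>c\<in>partial_partitions n N (m - 1) \<times> {..N}. F (open_block (Suc n) True c))"
proof -
  let ?A = "grow (Suc n) False ` grow_dom n (Suc N) (Suc m)"
  let ?B = "grow (Suc n) True ` grow_dom n (Suc N) m"
  let ?C = "open_block (Suc n) False ` (partial_partitions n N m \<times> {..N})"
  let ?D = "if m = 0 then {}
            else open_block (Suc n) True ` (partial_partitions n N (m - 1) \<times> {..N})"
  have fin: "finite (grow_dom n N' m')" for N' m'
    unfolding grow_dom_def by (intro finite_SigmaI finite_partial_partitions) auto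
  have finA: "finite ?A" "finite ?B" "finite ?C" "finite ?D"
    using fin finite_partial_partitions by auto
  \<comment> \<open>The count produced by \<open>grow_mem\<close> is \<open>m - 1 + 1\<close>, which
    equals \<open>m\<close> only because some block is active.\<close>
  have pos: "m > 0" if "(xs, j) \<in> grow_dom n N' m" for xs j N'
  proof -
    have "xs ! j \<in> set (filter snd xs)" "length (filter snd xs) = m"
      using that by (auto simp: grow_dom_def partial_partitions_altdef)
    thus ?thesis by (metis length_pos_if_in_set)
  qed
  have eq: "partial_partitions (Suc n) (Suc N) m = ?A \<union> ?B \<union> ?C \<union> ?D"
  proof (intro equalityI subsetI)
    fix xs assume "xs \<in> partial_partitions (Suc n) (Suc N) m"
    from partial_partitions_Suc_cases[OF this] show "xs \<in> ?A \<union> ?B \<union> ?C \<union> ?D" by auto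
  next
    fix xs assume "xs \<in> ?A \<union> ?B \<union> ?C \<union> ?D"
    then consider "xs \<in> ?A" | "xs \<in> ?B" | "xs \<in> ?C" | "xs \<in> ?D" by blast
    thus "xs \<in> partial_partitions (Suc n) (Suc N) m"
    proof cases
      case 1
      thus ?thesis using grow_mem[of _ _ n "Suc N" "Suc m" False] by auto
    next
      case 2
      then obtain ys j where "xs = grow (Suc n) True (ys, j)" "(ys, j) \<in> grow_dom n (Suc N) m" by auto
      thus ?thesis using grow_mem[of ys j n "Suc N" m True] pos by fastforce
    next
      case 3
      thus ?thesis using open_block_mem[of _ n N m False] by auto
    next
      case 4
      thus ?thesis using open_block_mem[of _ n N "m - 1" True] by (auto split: if_splits)
    qed
  qed
  have dis: "?A \<inter> ?B = {} \<and> (?A \<union> ?B) \<inter> ?C = {} \<and> (?A \<union> ?B \<union> ?C) \<inter> ?D = {}"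
  proof -
    let ?P = "\<lambda>xs :: (nat set \<times> bool) list. \<exists>p\<in>set xs. Suc n \<in> fst p \<and> snd p"
    let ?Q = "\<lambda>xs :: (nat set \<times> bool) list. {Suc n} \<in> fst ` set xs"
    have "\<forall>xs\<in>?A. \<not> ?P xs \<and> \<not> ?Q xs" "\<forall>xs\<in>?B. ?P xs \<and> \<not> ?Q xs"
      unfolding ball_simps
      by (simp_all only: grow_new_block[of _ n "Suc N" "Suc m"] grow_new_block[of _ n "Suc N" m]
            simp_thms ball_triv cong: ball_cong)
    moreover have "\<forall>xs\<in>?C. \<not> ?P xs \<and> ?Q xs" "\<forall>xs\<in>?D. ?P xs \<and> ?Q xs"
      unfolding ball_simps
      by (simp_all only: open_block_new_block[of _ n N m "{..N}"]
            open_block_new_block[of _ n N "m - 1" "{..N}"]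
            simp_thms ball_triv ball_simps if_cancel cong: ball_cong if_cong split: if_split)
    ultimately show ?thesis by (rule disjoint_if_separated[where P = ?P and Q = ?Q])
  qed
  have "sum F (partial_partitions (Suc n) (Suc N) m) = sum F ?A + sum F ?B + sum F ?C + sum F ?D"
    unfolding eq using finA dis by (simp only: sum.union_disjoint finite_UnI simp_thms)
  also have "sum F ?D = (if m = 0 then 0
     else \<Sum>c\<in>partial_partitions n N (m - 1) \<times> {..N}. F (open_block (Suc n) True c))"
    by (simp add: sum.reindex[OF inj_on_open_block])
  finally show ?thesis
    by (simp add: sum.reindex[OF inj_on_open_block] sum.reindex[OF inj_on_grow])
qed

section \<open>Multiplicative pair weights\<close>

fun list_weight :: "('b \<Rightarrow> 'b \<Rightarrow> 'a::comm_monoid_mult) \<Rightarrow> 'b list \<Rightarrow> 'a" where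
  "list_weight w [] = 1"
| "list_weight w (p # xs) = prod_list (map (w p) xs) * list_weight w xs"

lemma list_weight_insert:
  "list_weight w (ys @ p # zs) =
     list_weight w (ys @ zs) * prod_list (map (\<lambda>q. w q p) ys) * prod_list (map (w p) zs)"
  by (induction ys) (auto simp: ac_simps)

lemma list_weight_nth:
  "list_weight w xs = (\<Prod>b<length xs. \<Prod>a<b. w (xs ! a) (xs ! b))"
proof (induction xs rule: rev_induct)
  case (snoc p xs)
  have "prod_list (map (\<lambda>q. w q p) xs) = (\<Prod>a<length xs. w (xs ! a) p)"
    by (induction xs) (simp_all add: prod.lessThan_Suc_shift del: prod.lessThan_Suc)
  thus ?case using snoc list_weight_insert[of w xs p "[]"] by (simp add: nth_append)
qed simp

section \<open>Arithmetic of \<open>pq_int\<close>\<close>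

lemma pq_int_0 [simp]: "pq_int 0 p q = 0"
  by (simp add: pq_int_def)

lemma pq_int_Suc: "pq_int (Suc n) p q = p ^ n + q * pq_int n p q"
  unfolding pq_int_def sum.lessThan_Suc_shift
  by (simp add: sum_distrib_left algebra_simps)

text \<open>Cutting the defining sum at \<open>i = a\<close> gives the two summands. Both generating
  functions rest on this identity.\<close>

lemma pq_int_add: "pq_int (a + b) p q = q ^ a * pq_int b p q + p ^ b * pq_int a p q"
proof (induction a)
  case (Suc a)
  have "pq_int (Suc a + b) p q = p ^ (a + b) + q * pq_int (a + b) p q" by (simp add: pq_int_Suc)
  also have "\<dots> = q ^ Suc a * pq_int b p q + p ^ b * (p ^ a + q * pq_int a p q)"
    by (simp add: Suc algebra_simps power_add)
  finally show ?case by (simp add: pq_int_Suc)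
qed simp

text \<open>
  The behaviour of \<open>w\<close> when a new maximum \<open>v\<close> is put into an active block or opens a block of its own.
  The point of the last two assumptions is that the same \<open>h\<close> occurs on both sides: the position of
  a new block then only contributes \<open>(t * x) ^ r * (u * y) ^ l\<close>, whatever the flags of the other blocks.
\<close>
locale pair_weight =
  fixes w :: "nat set \<times> bool \<Rightarrow> nat set \<times> bool \<Rightarrow> 'a::comm_ring_1"
    and h :: "nat set \<times> bool \<Rightarrow> 'a" and x x' y t u :: 'a
  assumes insert_right: "\<lbrakk>finite A; A \<noteq> {}; finite B; B \<noteq> {}; \<forall>i\<in>A. i < v; \<forall>i\<in>B. i < v\<rbrakk> \<Longrightarrow>
      w (A, f) (insert v B, g) = (if f then y else x') * w (A, f) (B, True)"
    and insert_left: "\<lbrakk>finite A; A \<noteq> {}; finite B; B \<noteq> {}; \<forall>i\<in>A. i < v; \<forall>i\<in>B. i < v\<rbrakk> \<Longrightarrow>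
      w (insert v A, f) (B, g) = (if g then x else x') * w (A, True) (B, g)"
    and new_right: "\<lbrakk>finite A; A \<noteq> {}; \<forall>i\<in>A. i < v\<rbrakk> \<Longrightarrow> w (A, f) ({v}, g) = u * y * h (A, f)"
    and new_left: "\<lbrakk>finite B; B \<noteq> {}; \<forall>i\<in>B. i < v\<rbrakk> \<Longrightarrow> w ({v}, f) (B, g) = t * x * h (B, g)"
begin

text \<open>Every inactive block contributes \<open>x'\<close>. The active block with
  \<open>r\<close> active ones to its left contributes \<open>y ^ r\<close> and a power of
  \<open>x\<close> for those to its right, so the sum is the one defining
  \<open>pq_int\<close>.\<close>

lemma sum_active_positions:
  "(\<Sum>j<length xs. if snd (xs ! j) then
       prod_list (map (\<lambda>q :: nat set \<times> bool. if snd q then y else x') (take j xs)) *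
       prod_list (map (\<lambda>q. if snd q then x else x') (drop (Suc j) xs)) else 0) =
   x' ^ (length xs - length (filter snd xs)) * pq_int (length (filter snd xs)) x y"
proof (induction xs)
  case (Cons p xs)
  have *: "prod_list (map (\<lambda>q :: nat set \<times> bool. if snd q then x else x') xs) =
     x ^ length (filter snd xs) * x' ^ (length xs - length (filter snd xs))"
  proof (induction xs)
    case (Cons a xs)
    thus ?case using length_filter_le[of snd xs] by (auto simp: Suc_diff_le)
  qed simp
  have "length (p # xs) - length (filter snd (p # xs)) =
      (if snd p then length xs - length (filter snd xs)
       else Suc (length xs - length (filter snd xs)))"
    using length_filter_le[of snd xs] by (auto simp: Suc_diff_le)
  moreover have "(\<Sum>j<length xs. if snd (xs ! j) then (if snd p then y else x') *
       prod_list (map (\<lambda>q :: nat set \<times> bool. if snd q then y else x') (take j xs)) *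
       prod_list (map (\<lambda>q. if snd q then x else x') (drop (Suc j) xs)) else 0) =
     (if snd p then y else x') * 
       (x' ^ (length xs - length (filter snd xs)) * pq_int (length (filter snd xs)) x y)"
    unfolding Cons.IH[symmetric] sum_distrib_left by (intro sum.cong) (auto simp: mult.assoc)
  ultimately show ?case
    by (simp only: length_Cons sum.lessThan_Suc_shift nth_Cons_0 nth_Cons_Suc take_Suc_Cons
          drop_Suc_Cons list.map prod_list.Cons take_0 drop_0 prod_list.Nil)
       (auto simp: * pq_int_Suc algebra_simps)
qed simp

text \<open>Only pairs involving block \<open>j\<close> change, by one factor for each other block.
  The factors do not depend on \<open>g\<close>, so closing a block costs nothing extra.\<close>

lemma weight_grow:
  assumes xs: "xs \<in> partial_partitions n N m" "j < length xs" "snd (xs ! j)"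
  shows "list_weight w (grow (Suc n) g (xs, j)) =
     prod_list (map (\<lambda>q. if snd q then y else x') (take j xs)) *
     prod_list (map (\<lambda>q. if snd q then x else x') (drop (Suc j) xs)) * list_weight w xs"
proof -
  let ?ys = "take j xs" and ?zs = "drop (Suc j) xs"
  obtain B where B: "xs ! j = (B, True)" using xs(3) by (cases "xs ! j") auto
  have mem: "finite (fst q)" "fst q \<noteq> {}" "\<forall>i\<in>fst q. i < Suc n" if "q \<in> set xs" for q
    using partial_partitions_mem[OF xs(1) that] .
  have memB: "finite B" "B \<noteq> {}" "\<forall>i\<in>B. i < Suc n"
    using mem[OF nth_mem[OF xs(2)]] B by auto
  have l: "map (\<lambda>q. w q (insert (Suc n) B, g)) ?ys =
      map (\<lambda>q. (if snd q then y else x') * w q (B, True)) ?ys"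
  proof (intro map_cong refl)
    fix q assume "q \<in> set ?ys"
    hence "q \<in> set xs" by (rule in_set_takeD)
    thus "w q (insert (Suc n) B, g) = (if snd q then y else x') * w q (B, True)"
      using insert_right[of "fst q" B "Suc n" "snd q" g] mem memB by simp
  qed
  have r: "map (w (insert (Suc n) B, g)) ?zs =
      map (\<lambda>q. (if snd q then x else x') * w (B, True) q) ?zs"
  proof (intro map_cong refl)
    fix q assume "q \<in> set ?zs"
    hence "q \<in> set xs" by (rule in_set_dropD)
    thus "w (insert (Suc n) B, g) q = (if snd q then x else x') * w (B, True) q"
      using insert_left[of B "fst q" "Suc n" g "snd q"] mem memB by simp
  qed
  have mult: "prod_list (map (\<lambda>q. a q * b q) ys) = prod_list (map a ys) * prod_list (map b ys)"
    for a b :: "nat set \<times> bool \<Rightarrow> 'a" and ys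
    by (induction ys) (auto simp: ac_simps)
  have "xs = ?ys @ (B, True) # ?zs" using id_take_nth_drop[OF xs(2)] B by simp
  hence "list_weight w xs = list_weight w (?ys @ (B, True) # ?zs)" by (rule arg_cong)
  also have "\<dots> = list_weight w (?ys @ ?zs) * prod_list (map (\<lambda>q. w q (B, True)) ?ys) *
      prod_list (map (w (B, True)) ?zs)"
    by (rule list_weight_insert)
  finally show ?thesis
    by (simp only: grow_def B list_weight_insert l r mult prod.case fst_conv ac_simps)
qed

lemma weight_open_block:
  assumes xs: "xs \<in> partial_partitions n N m" "l \<le> N"
  shows "list_weight w (open_block (Suc n) g (xs, l)) =
     (u * y) ^ l * (t * x) ^ (N - l) * prod_list (map h xs) * list_weight w xs"
proof -
  let ?ys = "take l xs" and ?zs = "drop l xs"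
  have mem: "finite (fst q)" "fst q \<noteq> {}" "\<forall>i\<in>fst q. i < Suc n" if "q \<in> set xs" for q
    using partial_partitions_mem[OF xs(1) that] .
  have len: "length xs = N" using xs by (simp add: partial_partitions_altdef)
  have "map (\<lambda>q. w q ({Suc n}, g)) ?ys = map (\<lambda>q. (u * y) * h q) ?ys"
  proof (intro map_cong refl)
    fix q assume "q \<in> set ?ys"
    hence "q \<in> set xs" by (rule in_set_takeD)
    thus "w q ({Suc n}, g) = (u * y) * h q"
      using new_right[of "fst q" "Suc n" "snd q" g] mem by simp
  qed
  moreover have "map (w ({Suc n}, g)) ?zs = map (\<lambda>q. (t * x) * h q) ?zs"
  proof (intro map_cong refl)
    fix q assume "q \<in> set ?zs"
    hence "q \<in> set xs" by (rule in_set_dropD)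
    thus "w ({Suc n}, g) q = (t * x) * h q"
      using new_left[of "fst q" "Suc n" g "snd q"] mem by simp
  qed
  moreover have "prod_list (map (\<lambda>q. c * h q) ys) = c ^ length ys * prod_list (map h ys)" for c ys
    by (induction ys) (auto simp: ac_simps)
  moreover have "prod_list (map h xs) = prod_list (map h ?ys) * prod_list (map h ?zs)"
    by (metis append_take_drop_id map_append prod_list.append)
  ultimately show ?thesis using xs(2)
    by (simp only: open_block_def list_weight_insert prod.case append_take_drop_id length_take
          length_drop len min.absorb2) (simp only: ac_simps)
qed

definition total :: "nat \<Rightarrow> nat \<Rightarrow> nat \<Rightarrow> 'a" where
  "total n N m = sum (list_weight w) (partial_partitions n N m)"

lemma total_0: "total 0 N m = of_bool (N = 0 \<and> m = 0)"
proof -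
  have "partial_partitions 0 N m = (if N = 0 \<and> m = 0 then {[]} else {})"
  proof -
    have "xs = []" if "xs \<in> partial_partitions 0 N m" for xs
      using that unfolding partial_partitions_altdef by (cases xs) auto
    moreover have "[] \<in> partial_partitions 0 N m \<longleftrightarrow> N = 0 \<and> m = 0"
      by (auto simp: partial_partitions_altdef)
    ultimately show ?thesis by auto
  qed
  thus ?thesis by (simp add: total_def)
qed

lemma total_Suc_0: "total (Suc n) 0 m = 0"
proof -
  have "partial_partitions (Suc n) 0 m = {}" by (auto simp: partial_partitions_altdef)
  thus ?thesis by (simp add: total_def)
qed

lemma total_eq_0: "N < m \<Longrightarrow> total n N m = 0"
  by (simp add: total_def partial_partitions_empty)

lemma sum_weight_grow:
  "(\<Sum>c\<in>grow_dom n N m. list_weight w (grow (Suc n) g c)) =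
     x' ^ (N - m) * pq_int m x y * total n N m"
proof -
  have "(\<Sum>c\<in>grow_dom n N m. list_weight w (grow (Suc n) g c)) =
    (\<Sum>xs\<in>partial_partitions n N m. \<Sum>j\<in>{j. j < length xs \<and> snd (xs ! j)}.
       list_weight w (grow (Suc n) g (xs, j)))"
    unfolding grow_dom_def by (subst sum.Sigma) (auto intro: finite_partial_partitions)
  also have "\<dots> = (\<Sum>xs\<in>partial_partitions n N m. x' ^ (N - m) * pq_int m x y * list_weight w xs)"
  proof (intro sum.cong refl)
    fix xs assume xs: "xs \<in> partial_partitions n N m"
    hence len: "length xs = N" "length (filter snd xs) = m" by (auto simp: partial_partitions_altdef)
    let ?f = "\<lambda>j. prod_list (map (\<lambda>q. if snd q then y else x') (take j xs)) *
       prod_list (map (\<lambda>q. if snd q then x else x') (drop (Suc j) xs))"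
    have "(\<Sum>j\<in>{j. j < length xs \<and> snd (xs ! j)}. list_weight w (grow (Suc n) g (xs, j))) =
      (\<Sum>j\<in>{j \<in> {..<length xs}. snd (xs ! j)}. ?f j * list_weight w xs)"
      by (intro sum.cong) (auto simp: weight_grow[OF xs])
    also have "\<dots> = (\<Sum>j<length xs. if snd (xs ! j) then ?f j else 0) * list_weight w xs"
      unfolding sum_distrib_right by (subst sum.inter_filter) (auto intro!: sum.cong)
    finally show "(\<Sum>j\<in>{j. j < length xs \<and> snd (xs ! j)}. list_weight w (grow (Suc n) g (xs, j))) =
      x' ^ (N - m) * pq_int m x y * list_weight w xs"
      unfolding sum_active_positions by (simp only: len)
  qed
  finally show ?thesis by (simp add: total_def sum_distrib_left)
qed

text \<open>By the premise, the part of the weight that does not see the position depends on the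
  state only through its parameters; the geometric sum over the \<open>N + 1\<close> slots is
  \<open>pq_int\<close>.\<close>

lemma sum_weight_open_block:
  assumes "\<And>xs. xs \<in> partial_partitions n N m \<Longrightarrow> prod_list (map h xs) = H"
  shows "(\<Sum>c\<in>partial_partitions n N m \<times> {..N}. list_weight w (open_block (Suc n) g c)) =
     pq_int (Suc N) (t * x) (u * y) * (H * total n N m)"
proof -
  have "(\<Sum>c\<in>partial_partitions n N m \<times> {..N}. list_weight w (open_block (Suc n) g c)) =
    (\<Sum>xs\<in>partial_partitions n N m. \<Sum>l\<le>N. list_weight w (open_block (Suc n) g (xs, l)))"
    by (simp add: sum.cartesian_product)
  also have "\<dots> = (\<Sum>xs\<in>partial_partitions n N m. \<Sum>l\<le>N.
      (t * x) ^ (N - l) * (u * y) ^ l * (H * list_weight w xs))"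
    by (intro sum.cong refl) (simp add: weight_open_block assms ac_simps)
  also have "\<dots> = pq_int (Suc N) (t * x) (u * y) * (H * total n N m)"
    by (simp add: pq_int_def total_def sum_distrib_left sum_distrib_right lessThan_Suc_atMost
          sum.swap[of _ "{..N}"])
  finally show ?thesis .
qed

text \<open>From here on only the parameters \<open>n\<close>, \<open>N\<close>, \<open>m\<close>
  matter: this is the step recurrence of the weighted lattice paths.\<close>

lemma total_Suc:
  assumes "\<And>n N m xs. xs \<in> partial_partitions n N m \<Longrightarrow> prod_list (map h xs) = H n N m"
  shows "total (Suc n) (Suc N) m =
     x' ^ (Suc N - Suc m) * pq_int (Suc m) x y * total n (Suc N) (Suc m) +
     x' ^ (Suc N - m) * pq_int m x y * total n (Suc N) m +
     pq_int (Suc N) (t * x) (u * y) * (H n N m * total n N m +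
       (if m = 0 then 0 else H n N (m - 1) * total n N (m - 1)))"
proof -
  have "total (Suc n) (Suc N) m = sum (list_weight w) (partial_partitions (Suc n) (Suc N) m)"
    by (simp add: total_def)
  also note sum_partial_partitions_Suc
  also note sum_weight_grow
  also note sum_weight_grow
  also note sum_weight_open_block[OF assms]
  also note sum_weight_open_block[OF assms]
  finally show ?thesis by (auto simp: algebra_simps)
qed

end

section \<open>The two weights\<close>

text \<open>
  Each statistic is a sum over pairs of blocks; in a partial partition an active block counts as having
  maximum \<open>\<infinity>\<close>.
\<close>
definition pair_mak :: "nat set \<times> bool \<Rightarrow> nat set \<times> bool \<Rightarrow> nat" where
  "pair_mak p q = card {i \<in> fst p. Min (fst q) < i} +
     (if snd p then 0 else card {i \<in> fst q. Max (fst p) < i})"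

definition pair_lsb :: "nat set \<times> bool \<Rightarrow> nat set \<times> bool \<Rightarrow> nat" where
  "pair_lsb p q = card {i \<in> fst q. Min (fst p) < i \<and> (snd p \<or> i < Max (fst p))}"

text \<open>For closed disjoint blocks, these are the complements within the two blocks of what the
  pair contributes to \<open>los\<close> and \<open>rcs\<close>; see \<open>lmak_eq\<close>.\<close>

definition pair_lmak :: "nat set \<times> bool \<Rightarrow> nat set \<times> bool \<Rightarrow> nat" where
  "pair_lmak p q = card {i \<in> fst q. i < Min (fst p)} + card {i \<in> fst p. snd q \<or> i < Max (fst q)}"

definition pair_bInv :: "nat set \<times> bool \<Rightarrow> nat set \<times> bool \<Rightarrow> bool" where
  "pair_bInv p q \<longleftrightarrow> \<not> snd q \<and> Max (fst q) < Min (fst p)"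

definition pair_inv :: "nat set \<times> bool \<Rightarrow> nat set \<times> bool \<Rightarrow> bool" where
  "pair_inv p q \<longleftrightarrow> Min (fst q) < Min (fst p)"

text \<open>The \<open>+ 1\<close> in the exponent of \<open>y\<close>, once per pair, produces the
  summand \<open>k choose 2\<close> of \<open>cinvLSB\<close>.\<close>

definition mak_weight ::
    "'a::comm_ring_1 \<Rightarrow> 'a \<Rightarrow> 'a \<Rightarrow> 'a \<Rightarrow> nat set \<times> bool \<Rightarrow> nat set \<times> bool \<Rightarrow> 'a" where
  "mak_weight x y t u p q = x ^ (pair_mak p q + of_bool (pair_bInv p q)) *
     y ^ (pair_lsb p q + of_bool (\<not> pair_bInv p q) + 1) *
     t ^ of_bool (pair_inv p q) * u ^ of_bool (\<not> pair_inv p q)"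

definition lmak_weight ::
    "'a::comm_ring_1 \<Rightarrow> 'a \<Rightarrow> 'a \<Rightarrow> nat set \<times> bool \<Rightarrow> nat set \<times> bool \<Rightarrow> 'a" where
  "lmak_weight z t u p q = z ^ (pair_lmak p q + of_bool (pair_bInv p q)) *
     t ^ of_bool (pair_inv p q) * u ^ of_bool (\<not> pair_inv p q)"

section \<open>Effect of a new maximum on the pair statistics\<close>

lemma Min_insert_greater:
  fixes v :: nat
  assumes "finite B" "B \<noteq> {}" "\<forall>i\<in>B. i < v"
  shows "Min (insert v B) = Min B"
  using assms by (simp add: min_absorb2 order.strict_implies_order)

lemma Max_insert_greater:
  fixes v :: nat
  assumes "finite B" "\<forall>i\<in>B. i < v"
  shows "Max (insert v B) = v"
  using assms by (intro Max_eqI) (auto intro: order.strict_implies_order)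

lemma card_filter_insert:
  assumes "finite B" "v \<notin> B"
  shows "card {i \<in> insert v B. P i} = of_bool (P v) + card {i \<in> B. P i}"
proof -
  have "{i \<in> insert v B. P i} = (if P v then insert v {i \<in> B. P i} else {i \<in> B. P i})" by auto
  thus ?thesis using assms by simp
qed

context
  fixes A B :: "nat set" and v :: nat
  assumes A: "finite A" "A \<noteq> {}" "\<forall>i\<in>A. i < v"
    and B: "finite B" "B \<noteq> {}" "\<forall>i\<in>B. i < v"
begin

private lemma facts: "Min A \<in> A" "Min B \<in> B" "Min A < v" "Min B < v" "Max A < v" "v \<notin> A" "v \<notin> B"
    "\<not> v < Min A" "\<not> v < Min B" "\<not> v < Max B" "Max B < v"
    "{i \<in> A. v < i} = {}" "{i \<in> B. v < i} = {}"
proof -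
  show "Min A \<in> A" "Min B \<in> B" using A B by auto
  moreover have "Max A \<in> A" "Max B \<in> B" using A B by auto
  ultimately show "Min A < v" "Min B < v" "Max A < v" "Max B < v"
    "\<not> v < Min A" "\<not> v < Min B" "\<not> v < Max B"
    using A(3) B(3) by (auto simp: not_less intro: order.strict_implies_order)
  show "v \<notin> A" "v \<notin> B" "{i \<in> A. v < i} = {}" "{i \<in> B. v < i} = {}" using A B by auto
qed

text \<open>The new maximum \<open>v\<close> exceeds all of \<open>A\<close>, so towards
  \<open>A\<close> it behaves like the infinite maximum of an active block. This explains the flag
  \<open>True\<close> on the right, whatever \<open>g\<close> is.\<close>

lemma pair_insert_right:
  "pair_mak (A, f) (insert v B, g) = of_bool (\<not> f) + pair_mak (A, f) (B, True)"
  "pair_lsb (A, f) (insert v B, g) = of_bool f + pair_lsb (A, f) (B, True)"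
  "pair_lmak (A, f) (insert v B, g) = pair_lmak (A, f) (B, True)"
  "pair_bInv (A, f) (insert v B, g) \<longleftrightarrow> pair_bInv (A, f) (B, True)"
  "pair_inv (A, f) (insert v B, g) \<longleftrightarrow> pair_inv (A, f) (B, True)"
proof -
  have *: "{i \<in> A. g \<or> i < v} = A" using A by auto
  show "pair_mak (A, f) (insert v B, g) = of_bool (\<not> f) + pair_mak (A, f) (B, True)"
    "pair_lsb (A, f) (insert v B, g) = of_bool f + pair_lsb (A, f) (B, True)"
    "pair_lmak (A, f) (insert v B, g) = pair_lmak (A, f) (B, True)"
    "pair_bInv (A, f) (insert v B, g) \<longleftrightarrow> pair_bInv (A, f) (B, True)"
    "pair_inv (A, f) (insert v B, g) \<longleftrightarrow> pair_inv (A, f) (B, True)"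
    unfolding pair_mak_def pair_lsb_def pair_lmak_def pair_bInv_def pair_inv_def fst_conv snd_conv
      Min_insert_greater[OF B] Max_insert_greater[OF B(1,3)]
      card_filter_insert[OF B(1) facts(7)]
    using facts * by (auto simp: not_less)
qed

lemma pair_insert_left:
  "pair_mak (insert v A, f) (B, g) = 1 + pair_mak (A, True) (B, g)"
  "pair_lsb (insert v A, f) (B, g) = pair_lsb (A, True) (B, g)"
  "pair_lmak (insert v A, f) (B, g) = of_bool g + pair_lmak (A, True) (B, g)"
  "pair_bInv (insert v A, f) (B, g) \<longleftrightarrow> pair_bInv (A, True) (B, g)"
  "pair_inv (insert v A, f) (B, g) \<longleftrightarrow> pair_inv (A, True) (B, g)"
proof -
  have *: "{i \<in> B. Min A < i \<and> (f \<or> i < v)} = {i \<in> B. Min A < i}" using B by auto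
  show "pair_mak (insert v A, f) (B, g) = 1 + pair_mak (A, True) (B, g)"
    "pair_lsb (insert v A, f) (B, g) = pair_lsb (A, True) (B, g)"
    "pair_lmak (insert v A, f) (B, g) = of_bool g + pair_lmak (A, True) (B, g)"
    "pair_bInv (insert v A, f) (B, g) \<longleftrightarrow> pair_bInv (A, True) (B, g)"
    "pair_inv (insert v A, f) (B, g) \<longleftrightarrow> pair_inv (A, True) (B, g)"
    unfolding pair_mak_def pair_lsb_def pair_lmak_def pair_bInv_def pair_inv_def fst_conv snd_conv
      Min_insert_greater[OF A] Max_insert_greater[OF A(1,3)]
      card_filter_insert[OF A(1) facts(6)] facts(13)
    using facts * by auto
qed

end

context
  fixes A :: "nat set" and v :: nat
  assumes A: "finite A" "A \<noteq> {}" "\<forall>i\<in>A. i < v"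
begin

lemma pair_new_right:
  "pair_mak (A, f) ({v}, g) = of_bool (\<not> f)"
  "pair_lsb (A, f) ({v}, g) = of_bool f"
  "pair_lmak (A, f) ({v}, g) = card A"
  "\<not> pair_bInv (A, f) ({v}, g)"
  "\<not> pair_inv (A, f) ({v}, g)"
proof -
  have f: "Min A < v" "Max A < v" using A by auto
  have s: "{i \<in> A. v < i} = {}" "{i \<in> A. g \<or> i < v} = A"
    "{i \<in> {v}. P i} = (if P v then {v} else {})" for P using A by auto
  show "pair_mak (A, f) ({v}, g) = of_bool (\<not> f)"
    "pair_lsb (A, f) ({v}, g) = of_bool f"
    "pair_lmak (A, f) ({v}, g) = card A"
    "\<not> pair_bInv (A, f) ({v}, g)"
    "\<not> pair_inv (A, f) ({v}, g)"
    unfolding pair_mak_def pair_lsb_def pair_lmak_def pair_bInv_def pair_inv_def fst_conv snd_conv s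
      Min_singleton Max_singleton
    using f by (auto simp: not_less)
qed

lemma pair_new_left:
  "pair_mak ({v}, f) (A, g) = 1"
  "pair_lsb ({v}, f) (A, g) = 0"
  "pair_lmak ({v}, f) (A, g) = card A + of_bool g"
  "pair_bInv ({v}, f) (A, g) \<longleftrightarrow> \<not> g"
  "pair_inv ({v}, f) (A, g)"
proof -
  have f: "Min A < v" "Max A < v" using A by auto
  have s: "{i \<in> A. v < i} = {}" "{i \<in> A. i < v} = A" "{i \<in> A. v < i \<and> Q i} = {}"
    "{i \<in> {v}. P i} = (if P v then {v} else {})" for P Q using A by auto
  show "pair_mak ({v}, f) (A, g) = 1"
    "pair_lsb ({v}, f) (A, g) = 0"
    "pair_lmak ({v}, f) (A, g) = card A + of_bool g"
    "pair_bInv ({v}, f) (A, g) \<longleftrightarrow> \<not> g"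
    "pair_inv ({v}, f) (A, g)"
    unfolding pair_mak_def pair_lsb_def pair_lmak_def pair_bInv_def pair_inv_def fst_conv snd_conv s
      Min_singleton Max_singleton
    using f by (auto simp: not_less)
qed

end

text \<open>When the new block stands to the left of a closed one, \<open>pair_bInv\<close> turns
  one factor \<open>y\<close> into \<open>x\<close>. This is what makes \<open>h\<close> agree on
  both sides.\<close>

interpretation mak: pair_weight "mak_weight x y t u" "\<lambda>p. if snd p then y\<^sup>2 else x * y" x x y t u
  for x y t u :: "'a::comm_ring_1"
  by unfold_locales
     (simp_all add: mak_weight_def pair_insert_right pair_insert_left pair_new_right pair_new_left
        pair_bInv_def[of _ "(_, True)"] power2_eq_square ac_simps)

text \<open>A block to the right of the new one costs one extra \<open>z\<close>: through
  \<open>pair_lmak\<close> if it is active, through \<open>pair_bInv\<close> if it is closed. So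
  \<open>h\<close> does not see the flag.\<close>

interpretation lmak: pair_weight "lmak_weight z t u" "\<lambda>p. z ^ card (fst p)" z 1 1 t u
  for z t u :: "'a::comm_ring_1"
  by unfold_locales
     (simp_all add: lmak_weight_def pair_insert_right pair_insert_left pair_new_right pair_new_left
        power_add ac_simps)

lemma prod_h_mak:
  assumes "xs \<in> partial_partitions n N m"
  shows "prod_list (map (\<lambda>p. if snd p then y\<^sup>2 else x * y) xs) = x ^ (N - m) * (y :: 'a::comm_ring_1) ^ (N + m)"
proof -
  have "prod_list (map (\<lambda>p :: nat set \<times> bool. if snd p then y\<^sup>2 else x * y) xs) =
    x ^ (length xs - length (filter snd xs)) * y ^ (length xs + length (filter snd xs))"
  proof (induction xs)
    case (Cons a xs)
    thus ?case using length_filter_le[of snd xs] by (auto simp: Suc_diff_le power2_eq_square ac_simps)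
  qed simp
  thus ?thesis using assms by (simp add: partial_partitions_altdef)
qed

lemma sum_card_blocks:
  assumes "sorted_wrt disjnt bs" "\<forall>B\<in>set bs. finite B"
  shows "sum_list (map card bs) = card (\<Union>(set bs))"
  using assms
proof (induction bs)
  case (Cons B bs)
  have "card (B \<union> \<Union>(set bs)) = card B + card (\<Union>(set bs))"
    using Cons.prems by (intro card_Un_disjoint) (auto simp: disjnt_def)
  thus ?case using Cons by simp
qed simp

lemma prod_h_lmak:
  assumes "xs \<in> partial_partitions n N m"
  shows "prod_list (map (\<lambda>p. z ^ card (fst p)) xs) = (z :: 'a::comm_ring_1) ^ n"
proof -
  have "map fst xs \<in> ordered_partitions n N" using assms by (simp add: partial_partitions_def)
  hence "sorted_wrt disjnt (map fst xs)" and un: "\<Union>(set (map fst xs)) = {1..n}"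
    by (auto simp: ordered_partitions_altdef)
  moreover have "\<forall>B\<in>set (map fst xs). finite B"
    using partial_partitions_mem(1)[OF assms] by auto
  ultimately have "sum_list (map card (map fst xs)) = card (\<Union>(set (map fst xs)))"
    by (intro sum_card_blocks)
  hence "sum_list (map card (map fst xs)) = n" unfolding un by simp
  moreover have "prod_list (map (\<lambda>p. z ^ card (fst p)) xs) = z ^ sum_list (map card (map fst xs))"
    by (induction xs) (auto simp: power_add)
  ultimately show ?thesis by simp
qed

section \<open>The statistics as sums over pairs of blocks\<close>

lemma sum_pairs_less:
  fixes f :: "nat \<Rightarrow> nat \<Rightarrow> 'a::comm_semiring_1"
  shows "(\<Sum>a<k. \<Sum>b<k. of_bool (a < b) * f a b) = (\<Sum>b<k. \<Sum>a<b. f a b)"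
proof -
  have "(\<Sum>a<k. of_bool (a < b) * f a b) = (\<Sum>a<b. f a b)" if "b < k" for b
  proof -
    have "(\<Sum>a<b. f a b) = (\<Sum>a<b. of_bool (a < b) * f a b)" by simp
    also have "\<dots> = (\<Sum>a<k. of_bool (a < b) * f a b)"
      using that by (intro sum.mono_neutral_left) auto
    finally show ?thesis by simp
  qed
  thus ?thesis by (subst sum.swap) simp
qed

lemma card_pairs_less:
  fixes k :: nat
  shows "card {(a, b). a < b \<and> b < k \<and> P a b} = (\<Sum>b<k. \<Sum>a<b. of_bool (P a b))"
proof -
  have "{(a, b). a < b \<and> b < k \<and> P a b} = (SIGMA b:{..<k}. {a \<in> {..<b}. P a b})\<inverse>" by auto
  hence "card {(a, b). a < b \<and> b < k \<and> P a b} = card (SIGMA b:{..<k}. {a \<in> {..<b}. P a b})"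
    by simp
  also have "\<dots> = (\<Sum>b<k. card {a \<in> {..<b}. P a b})" by (rule card_SigmaI) auto
  finally show ?thesis by (simp add: Int_def)
qed

lemma choose_two_eq_sum: "k choose 2 = (\<Sum>b<k. \<Sum>a<b. 1)"
  by (induction k) (auto simp: numeral_2_eq_2)

lemma choose_two_diff:
  "(k choose 2) - card {(a, b). a < b \<and> b < k \<and> P a b} = (\<Sum>b<k. \<Sum>a<b. of_bool (\<not> P a b))"
proof -
  have "k choose 2 = (\<Sum>b<k. \<Sum>a<b. of_bool (P a b)) + (\<Sum>b<k. \<Sum>a<b. of_bool (\<not> P a b))"
    unfolding choose_two_eq_sum sum.distrib[symmetric] by (intro sum.cong) auto
  thus ?thesis by (simp add: card_pairs_less)
qed

text \<open>Each index occurs in \<open>k - 1\<close> of the pairs.\<close>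

lemma sum_pairs_add:
  fixes c :: "nat \<Rightarrow> nat"
  shows "(\<Sum>b<k. \<Sum>a<b. c a + c b) = (k - 1) * (\<Sum>a<k. c a)"
proof (induction k)
  case (Suc k)
  have "(\<Sum>b<Suc k. \<Sum>a<b. c a + c b) = (k - 1) * (\<Sum>a<k. c a) + (\<Sum>a<k. c a) + k * c k"
    using Suc by (simp add: sum.distrib)
  thus ?case by (cases k) (simp_all add: algebra_simps)
qed simp

context
  fixes n k :: nat and \<pi> :: "nat set list"
  assumes \<pi>: "\<pi> \<in> ordered_partitions n k"
begin

lemma sum_ground: "(\<Sum>i\<in>ground \<pi>. f i) = (\<Sum>a<k. \<Sum>i\<in>\<pi> ! a. f i)"
proof -
  have "ground \<pi> = (\<Union>a\<in>{..<k}. \<pi> ! a)"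
    using length_op[OF \<pi>] by (auto simp: ground_def set_conv_nth)
  moreover have "\<forall>a\<in>{..<k}. \<forall>b\<in>{..<k}. a \<noteq> b \<longrightarrow> \<pi> ! a \<inter> \<pi> ! b = {}"
    using \<pi> by (auto simp: ordered_partitions_def)
  ultimately show ?thesis
    using nth_op(1)[OF \<pi>] by (simp add: sum.UNION_disjoint)
qed

lemma sum_of_bool_block:
  assumes "a < k"
  shows "(\<Sum>i\<in>\<pi> ! a. of_bool (P i)) = card {i \<in> \<pi> ! a. P i}"
  using nth_op(1)[OF \<pi> assms] by (simp add: Int_def)

text \<open>Openers and closers correspond to blocks via \<open>block\<close>, so one exchange of
  summation serves all four statistics: \<open>M\<close> is \<open>Min\<close> or
  \<open>Max\<close>, and \<open>r\<close> selects the side.\<close>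

lemma sum_coordinate_statistic:
  assumes M: "\<forall>a<k. M (\<pi> ! a) \<in> \<pi> ! a"
  shows "(\<Sum>i\<in>ground \<pi>. card {j \<in> M ` set \<pi>. j < i \<and> r (block \<pi> j) (block \<pi> i)}) =
    (\<Sum>a<k. \<Sum>b<k. of_bool (r b a) * card {i \<in> \<pi> ! a. M (\<pi> ! b) < i})"
  unfolding sum_ground
proof (rule sum.cong[OF refl])
  fix a assume "a \<in> {..<k}"
  hence a: "a < k" by simp
  have "(\<Sum>i\<in>\<pi> ! a. card {j \<in> M ` set \<pi>. j < i \<and> r (block \<pi> j) (block \<pi> i)}) =
    (\<Sum>i\<in>\<pi> ! a. \<Sum>b<k. of_bool (M (\<pi> ! b) < i \<and> r b a))"
  proof (intro sum.cong refl)
    fix i assume i: "i \<in> \<pi> ! a"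
    have set: "set \<pi> = (\<lambda>b. \<pi> ! b) ` {..<k}" using length_op[OF \<pi>] by (auto simp: in_set_conv_nth)
    have bl: "block \<pi> (M (\<pi> ! b)) = b" if "b < k" for b using block_op[OF \<pi> that] M that by blast
    have "{j \<in> M ` set \<pi>. j < i \<and> r (block \<pi> j) (block \<pi> i)} =
       (\<lambda>b. M (\<pi> ! b)) ` {b \<in> {..<k}. M (\<pi> ! b) < i \<and> r b a}"
      unfolding set block_op[OF \<pi> a i] using bl by auto
    moreover have "inj_on (\<lambda>b. M (\<pi> ! b)) {b \<in> {..<k}. M (\<pi> ! b) < i \<and> r b a}"
      by (rule inj_on_inverseI[of _ "block \<pi>"]) (simp add: bl)
    ultimately show "card {j \<in> M ` set \<pi>. j < i \<and> r (block \<pi> j) (block \<pi> i)} =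
       (\<Sum>b<k. of_bool (M (\<pi> ! b) < i \<and> r b a))"
      by (simp add: card_image Int_def)
  qed
  also have "\<dots> = (\<Sum>b<k. \<Sum>i\<in>\<pi> ! a. of_bool (M (\<pi> ! b) < i \<and> r b a))" by (rule sum.swap)
  also have "\<dots> = (\<Sum>b<k. of_bool (r b a) * card {i \<in> \<pi> ! a. M (\<pi> ! b) < i})"
    by (intro sum.cong refl) (simp add: sum_of_bool_block[OF a])
  finally show "(\<Sum>i\<in>\<pi> ! a. card {j \<in> M ` set \<pi>. j < i \<and> r (block \<pi> j) (block \<pi> i)}) =
    (\<Sum>b<k. of_bool (r b a) * card {i \<in> \<pi> ! a. M (\<pi> ! b) < i})" .
qed

lemma Min_Max_mem: "\<forall>a<k. Min (\<pi> ! a) \<in> \<pi> ! a" "\<forall>a<k. Max (\<pi> ! a) \<in> \<pi> ! a"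
  using nth_op[OF \<pi>] by auto

lemma ros_eq: "ros \<pi> = (\<Sum>b<k. \<Sum>a<b. card {i \<in> \<pi> ! a. Min (\<pi> ! b) < i})"
  unfolding ros_def ros_at_def openers_def
    sum_coordinate_statistic[of Min "\<lambda>b a. a < b", OF Min_Max_mem(1)]
  by (rule sum_pairs_less)

lemma los_eq: "los \<pi> = (\<Sum>b<k. \<Sum>a<b. card {i \<in> \<pi> ! b. Min (\<pi> ! a) < i})"
  unfolding los_def los_at_def openers_def
    sum_coordinate_statistic[of Min "\<lambda>b a. b < a", OF Min_Max_mem(1)]
  by (subst sum.swap) (rule sum_pairs_less)

lemma rcs_eq: "rcs \<pi> = (\<Sum>b<k. \<Sum>a<b. card {i \<in> \<pi> ! a. Max (\<pi> ! b) < i})"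
  unfolding rcs_def rcs_at_def closers_def
    sum_coordinate_statistic[of Max "\<lambda>b a. a < b", OF Min_Max_mem(2)]
  by (rule sum_pairs_less)

lemma lcs_eq: "lcs \<pi> = (\<Sum>b<k. \<Sum>a<b. card {i \<in> \<pi> ! b. Max (\<pi> ! a) < i})"
  unfolding lcs_def lcs_at_def closers_def
    sum_coordinate_statistic[of Max "\<lambda>b a. b < a", OF Min_Max_mem(2)]
  by (subst sum.swap) (rule sum_pairs_less)

lemma lsb_eq:
  "lsb \<pi> = (\<Sum>b<k. \<Sum>a<b. card {i \<in> \<pi> ! b. Min (\<pi> ! a) < i \<and> i < Max (\<pi> ! a)})"
  unfolding lsb_def sum_ground
proof (rule sum.cong[OF refl])
  fix b assume "b \<in> {..<k}"
  hence b: "b < k" by simp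
  let ?P = "\<lambda>a i. Min (\<pi> ! a) < i \<and> i < Max (\<pi> ! a)"
  have "(\<Sum>i\<in>\<pi> ! b. lsb_at \<pi> i) = (\<Sum>i\<in>\<pi> ! b. \<Sum>a<b. of_bool (?P a i))"
  proof (intro sum.cong refl)
    fix i assume "i \<in> \<pi> ! b"
    hence "lsb_at \<pi> i = card {a \<in> {..<b}. ?P a i}"
      using block_op[OF \<pi> b] by (simp add: lsb_at_def)
    thus "lsb_at \<pi> i = (\<Sum>a<b. of_bool (?P a i))" by (simp add: Int_def)
  qed
  also have "\<dots> = (\<Sum>a<b. \<Sum>i\<in>\<pi> ! b. of_bool (?P a i))" by (rule sum.swap)
  finally show "(\<Sum>i\<in>\<pi> ! b. lsb_at \<pi> i) = (\<Sum>a<b. card {i \<in> \<pi> ! b. ?P a i})"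
    by (simp only: sum_of_bool_block[OF b])
qed

lemma bInv_eq_card:
  "bInv \<pi> = card {(a, b). a < b \<and> b < k \<and> Max (\<pi> ! b) < Min (\<pi> ! a)}"
proof -
  have "(\<forall>v\<in>\<pi> ! a. \<forall>w\<in>\<pi> ! b. w < v) \<longleftrightarrow> Max (\<pi> ! b) < Min (\<pi> ! a)" if "a < k" "b < k" for a b
    using nth_op[OF \<pi> that(1)] nth_op[OF \<pi> that(2)]
    by (metis Max_ge Min_le le_less_trans less_le_trans)
  hence "(a < b \<and> b < k \<and> (\<forall>v\<in>\<pi> ! a. \<forall>w\<in>\<pi> ! b. w < v)) \<longleftrightarrow>
    (a < b \<and> b < k \<and> Max (\<pi> ! b) < Min (\<pi> ! a))" for a b
    using order.strict_trans by blast
  thus ?thesis by (simp only: bInv_def length_op[OF \<pi>])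
qed

lemma disjoint_op: "a < b \<Longrightarrow> b < k \<Longrightarrow> \<pi> ! a \<inter> \<pi> ! b = {}"
  using \<pi> by (auto simp: ordered_partitions_def)

text \<open>Adding \<open>los\<close> and \<open>rcs\<close> to the right-hand side counts all
  elements of both blocks of each pair, since an extremal element of one block is not in the other.
  The total is \<open>n * (k - 1)\<close>.\<close>

lemma lmak_eq:
  "lmak \<pi> = (\<Sum>b<k. \<Sum>a<b. card {i \<in> \<pi> ! b. i < Min (\<pi> ! a)} + card {i \<in> \<pi> ! a. i < Max (\<pi> ! b)})"
    (is "_ = ?L")
proof -
  have split: "card {i \<in> B. i < c} + card {i \<in> B. c < i} = card B"
    if "finite B" "c \<notin> B" for B and c :: nat
  proof -
    have "B = {i \<in> B. i < c} \<union> {i \<in> B. c < i}" using that by (auto, metis linorder_neqE_nat)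
    moreover have "{i \<in> B. i < c} \<inter> {i \<in> B. c < i} = {}" by auto
    ultimately show ?thesis using that by (metis card_Un_disjoint finite_Un)
  qed
  have "?L + (los \<pi> + rcs \<pi>) = (\<Sum>b<k. \<Sum>a<b. card (\<pi> ! a) + card (\<pi> ! b))"
    unfolding los_eq rcs_eq sum.distrib[symmetric]
  proof (intro sum.cong refl)
    fix a b assume "b \<in> {..<k}" "a \<in> {..<b}"
    hence ab: "a < b" "b < k" "a < k" by auto
    have "Min (\<pi> ! a) \<notin> \<pi> ! b" "Max (\<pi> ! b) \<notin> \<pi> ! a"
      using disjoint_op[OF ab(1,2)] nth_op[OF \<pi> ab(2)] nth_op[OF \<pi> ab(3)] by auto
    from split[OF _ this(1)] split[OF _ this(2)]
    show "card {i \<in> \<pi> ! b. i < Min (\<pi> ! a)} + card {i \<in> \<pi> ! a. i < Max (\<pi> ! b)} +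
      (card {i \<in> \<pi> ! b. Min (\<pi> ! a) < i} + card {i \<in> \<pi> ! a. Max (\<pi> ! b) < i}) =
      card (\<pi> ! a) + card (\<pi> ! b)"
      using nth_op(1)[OF \<pi>] ab by simp
  qed
  also have "\<dots> = (k - 1) * (\<Sum>a<k. card (\<pi> ! a))" by (rule sum_pairs_add)
  also have "(\<Sum>a<k. card (\<pi> ! a)) = card (ground \<pi>)"
    using sum_ground[of "\<lambda>_. 1 :: nat"] by (simp only: card_eq_sum)
  finally have "?L + (los \<pi> + rcs \<pi>) = card (ground \<pi>) * (length \<pi> - 1)"
    using length_op[OF \<pi>] by simp
  thus ?thesis by (simp add: lmak_def)
qed

lemma list_weight_op:
  "list_weight w (map (\<lambda>B. (B, False)) \<pi>) = (\<Prod>b<k. \<Prod>a<b. w (\<pi> ! a, False) (\<pi> ! b, False))"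
  unfolding list_weight_nth using length_op[OF \<pi>] by simp

lemma op_cinv_eq: "op_cinv \<pi> = (\<Sum>b<k. \<Sum>a<b. of_bool (\<not> Min (\<pi> ! b) < Min (\<pi> ! a)))"
  unfolding op_cinv_def op_inv_eq[OF \<pi>] length_op[OF \<pi>] choose_two_diff ..

lemma mak_weight_op:
  "list_weight (mak_weight x y t u) (map (\<lambda>B. (B, False)) \<pi>) =
     x ^ (mak \<pi> + bInv \<pi>) * y ^ cinvLSB \<pi> * t ^ op_inv \<pi> * u ^ op_cinv \<pi>"
proof -
  have "mak \<pi> + bInv \<pi> = (\<Sum>b<k. \<Sum>a<b. pair_mak (\<pi> ! a, False) (\<pi> ! b, False) +
      of_bool (pair_bInv (\<pi> ! a, False) (\<pi> ! b, False)))"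
    unfolding mak_def ros_eq lcs_eq bInv_eq_card card_pairs_less
    by (simp add: pair_mak_def pair_bInv_def sum.distrib)
  moreover have "cinvLSB \<pi> = (\<Sum>b<k. \<Sum>a<b. pair_lsb (\<pi> ! a, False) (\<pi> ! b, False) +
      of_bool (\<not> pair_bInv (\<pi> ! a, False) (\<pi> ! b, False)) + 1)"
    unfolding cinvLSB_def cbInv_def lsb_eq bInv_eq_card length_op[OF \<pi>] choose_two_diff
    unfolding choose_two_eq_sum
    by (simp only: pair_lsb_def pair_bInv_def sum.distrib fst_conv snd_conv simp_thms)
  ultimately show ?thesis
    unfolding op_inv_eq[OF \<pi>] card_pairs_less op_cinv_eq list_weight_op
    by (simp only: mak_weight_def prod.distrib power_sum pair_inv_def fst_conv)
qed

lemma lmak_weight_op: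
  "list_weight (lmak_weight z t u) (map (\<lambda>B. (B, False)) \<pi>) =
     z ^ (lmak \<pi> + bInv \<pi>) * t ^ op_inv \<pi> * u ^ op_cinv \<pi>"
proof -
  have "lmak \<pi> + bInv \<pi> = (\<Sum>b<k. \<Sum>a<b. pair_lmak (\<pi> ! a, False) (\<pi> ! b, False) +
      of_bool (pair_bInv (\<pi> ! a, False) (\<pi> ! b, False)))"
    unfolding lmak_eq bInv_eq_card card_pairs_less
    by (simp add: pair_lmak_def pair_bInv_def sum.distrib)
  thus ?thesis
    unfolding op_inv_eq[OF \<pi>] card_pairs_less op_cinv_eq list_weight_op
    by (simp only: lmak_weight_def prod.distrib power_sum pair_inv_def fst_conv)
qed

end

section \<open>From states without active blocks back to ordered partitions\<close>

lemma partial_partitions_closed: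
  "partial_partitions n k 0 = map (\<lambda>B. (B, False)) ` ordered_partitions n k"
proof (intro equalityI subsetI)
  fix xs assume xs: "xs \<in> partial_partitions n k 0"
  hence "\<forall>p\<in>set xs. \<not> snd p" by (auto simp: partial_partitions_def filter_empty_conv)
  hence "xs = map (\<lambda>B. (B, False)) (map fst xs)" by (induction xs) auto
  thus "xs \<in> map (\<lambda>B. (B, False)) ` ordered_partitions n k"
    using xs unfolding partial_partitions_def by blast
qed (auto simp: partial_partitions_def o_def filter_map)

lemma (in pair_weight) total_closed:
  "total n k 0 = (\<Sum>\<pi>\<in>ordered_partitions n k. list_weight w (map (\<lambda>B. (B, False)) \<pi>))"
  unfolding total_def partial_partitions_closed
  by (subst sum.reindex) (auto intro!: inj_onI dest: map_injective simp: inj_def)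

lemma phi_mak_nth: "fps_nth (phi_mak k x y t u) n = mak.total x y t u n k 0"
  by (simp add: phi_mak_def mak.total_closed mak_weight_op)

lemma phi_lmak_nth: "fps_nth (phi_lmak k z t u) n = lmak.total z t u n k 0"
  by (simp add: phi_lmak_def lmak.total_closed lmak_weight_op)

section \<open>The generating function of mak\<close>

lemma pq_int_commute: "pq_int n p q = pq_int n q p"
  unfolding pq_int_def by (subst sum.nat_diff_reindex[symmetric]) (auto intro!: sum.cong simp: mult.commute)

lemma pq_fact_Suc: "pq_fact (Suc n) p q = pq_fact n p q * pq_int (Suc n) p q"
  by (simp add: pq_fact_def)

lemma fps_nth_0_prod_one_minus:
  fixes k :: nat
  shows "fps_nth (\<Prod>i=1..k. 1 - fps_X * fps_const (e i :: 'a::field)) 0 = 1"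
  by (induction k) (auto simp: fps_mult_nth_0)

text \<open>
  The coefficients of \<open>(xy)\<^bsup>N(N-1)/2\<^esup> \<Prod>\<^bsub>i<N\<^esub> (1 + (y/x)\<^sup>i w)\<close> in \<open>w\<close>, written without division. With \<open>w\<close>
  marking active blocks, \<open>mak_coeff_eigen\<close> says that this polynomial is an eigenvector, with
  eigenvalue \<open>[N]\<close>, of adding an element to an active block.
\<close>
fun mak_coeff :: "'a::comm_ring_1 \<Rightarrow> 'a \<Rightarrow> nat \<Rightarrow> nat \<Rightarrow> 'a" where
  "mak_coeff x y 0 m = of_bool (m = 0)"
| "mak_coeff x y (Suc N) m = x ^ (N - m) * y ^ (N + m) * mak_coeff x y N m +
     (if m = 0 then 0 else x ^ (N - (m - 1)) * y ^ (N + (m - 1)) * mak_coeff x y N (m - 1))"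

lemma mak_coeff_eq_0: "N < m \<Longrightarrow> mak_coeff x y N m = 0"
  by (induction N arbitrary: m) auto

lemma mak_coeff_0: "mak_coeff x y N 0 = (x * y) ^ (N choose 2)"
  by (induction N) (simp_all add: numeral_2_eq_2 power_add power_mult_distrib)

text \<open>By the q-binomial theorem the coefficients are essentially Gaussian binomials in
  \<open>y / x\<close>; this is the quotient of consecutive ones, cross-multiplied. Writing the
  degree as \<open>m + Suc d\<close> avoids subtraction.\<close>

lemma mak_coeff_ratio:
  "x ^ d * pq_int (Suc m) x y * mak_coeff x y (m + Suc d) (Suc m) =
   y ^ m * pq_int (Suc d) x y * mak_coeff x y (m + Suc d) m"
proof (induction "m + d" arbitrary: m d)
  case 0
  thus ?case by (simp add: pq_int_def)
next
  case (Suc M)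
  define N where "N = Suc M"
  have N: "m + d = N" "m + Suc d = Suc N" using Suc N_def by auto
  let ?V = "mak_coeff x y N"
  \<comment> \<open>Induction hypothesis at \<open>d - 1\<close>; for \<open>d = 0\<close> both
    sides vanish.\<close>
  have 1: "x ^ d * pq_int (Suc m) x y * x ^ (N - Suc m) * ?V (Suc m) = x ^ d * (y ^ m * pq_int d x y * ?V m)"
  proof (cases d)
    case 0
    thus ?thesis using N by (simp add: mak_coeff_eq_0)
  next
    case (Suc d')
    hence "x ^ d' * pq_int (Suc m) x y * ?V (Suc m) = y ^ m * pq_int (Suc d') x y * ?V m"
      using Suc.hyps(1)[of m d'] N N_def by auto
    moreover have "N - Suc m = d'" using Suc N by simp
    ultimately show ?thesis using Suc by (simp add: mult.assoc mult.left_commute)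
  qed
  \<comment> \<open>Induction hypothesis at \<open>m - 1\<close>; for \<open>m = 0\<close> both
    sides vanish.\<close>
  have 2: "y ^ m * pq_int (Suc d) x y *
      (if m = 0 then 0 else x ^ (N - (m - 1)) * y ^ (N + (m - 1)) * ?V (m - 1)) =
      y ^ (N + m) * x ^ Suc d * (x ^ d * pq_int m x y * ?V m)"
  proof (cases m)
    case (Suc m')
    hence "x ^ d * pq_int (Suc m') x y * ?V (Suc m') = y ^ m' * pq_int (Suc d) x y * ?V m'"
      using Suc.hyps(1)[of m' d] N N_def by auto
    moreover have "N - m' = Suc d" using Suc N by simp
    ultimately show ?thesis using Suc by (simp add: algebra_simps power_add)
  qed simp
  have "x ^ d * pq_int (Suc m) x y * mak_coeff x y (Suc N) (Suc m) =
      y ^ (N + Suc m) * (x ^ d * pq_int (Suc m) x y * x ^ (N - Suc m) * ?V (Suc m)) +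
      x ^ d * pq_int (Suc m) x y * (x ^ (N - m) * y ^ (N + m) * ?V m)"
    by (simp add: algebra_simps)
  also have Nm: "N - m = d" using N by simp
  also have "y ^ (N + Suc m) * (x ^ d * pq_int (Suc m) x y * x ^ (N - Suc m) * ?V (Suc m)) +
      x ^ d * pq_int (Suc m) x y * (x ^ d * y ^ (N + m) * ?V m) =
      x ^ d * y ^ (N + m) * ?V m * (y ^ Suc m * pq_int d x y + x ^ d * pq_int (Suc m) x y)"
    unfolding 1 by (simp add: algebra_simps)
  \<comment> \<open>The core of the computation: \<open>pq_int (Suc N) x y\<close> is split once at
    \<open>m + 1\<close> and once at \<open>m\<close>.\<close>
  also have "y ^ Suc m * pq_int d x y + x ^ d * pq_int (Suc m) x y = pq_int (m + Suc d) x y"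
    using pq_int_add[of "Suc m" d x y] by simp
  also have "\<dots> = y ^ m * pq_int (Suc d) x y + x ^ Suc d * pq_int m x y"
    by (rule pq_int_add)
  also have "x ^ d * y ^ (N + m) * ?V m * \<dots> =
      y ^ m * pq_int (Suc d) x y * (x ^ d * y ^ (N + m) * ?V m) +
      y ^ (N + m) * x ^ Suc d * (x ^ d * pq_int m x y * ?V m)"
    by (simp add: algebra_simps)
  also have "\<dots> = y ^ m * pq_int (Suc d) x y * mak_coeff x y (Suc N) m"
    unfolding 2[symmetric] by (simp add: Nm algebra_simps)
  finally show ?case unfolding N .
qed

text \<open>\<open>mak_coeff_ratio\<close> expresses the first summand by the coefficient at
  \<open>m\<close>; then \<open>pq_int_add\<close> collects the scalars.\<close>

lemma mak_coeff_eigen: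
  "x ^ (Suc N - Suc m) * pq_int (Suc m) x y * mak_coeff x y (Suc N) (Suc m) +
   x ^ (Suc N - m) * pq_int m x y * mak_coeff x y (Suc N) m =
   pq_int (Suc N) x y * mak_coeff x y (Suc N) m"
proof (cases "m < Suc N")
  case True
  then obtain d where d: "Suc N = m + Suc d" using less_iff_Suc_add by auto
  have "x ^ d * pq_int (Suc m) x y * mak_coeff x y (Suc N) (Suc m) =
      y ^ m * pq_int (Suc d) x y * mak_coeff x y (Suc N) m"
    unfolding d by (rule mak_coeff_ratio)
  moreover have "pq_int (Suc N) x y = y ^ m * pq_int (Suc d) x y + x ^ Suc d * pq_int m x y"
    unfolding d by (rule pq_int_add)
  moreover have "Suc N - Suc m = d" "Suc N - m = Suc d" using d by auto
  ultimately show ?thesis by (simp only: distrib_right)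
next
  case False
  hence "m = Suc N \<or> Suc N < m" by auto
  thus ?thesis by (auto simp: mak_coeff_eq_0 simp del: mak_coeff.simps)
qed

text \<open>The claimed closed form without the power of \<open>x * y\<close>, which
  \<open>mak_coeff_0\<close> supplies.\<close>

definition mak_series :: "'a::field \<Rightarrow> 'a \<Rightarrow> 'a \<Rightarrow> 'a \<Rightarrow> nat \<Rightarrow> 'a fps" where
  "mak_series x y t u k = fps_X ^ k * fps_const (pq_fact k (t * x) (u * y)) /
     (\<Prod>i=1..k. 1 - fps_X * fps_const (pq_int i x y))"

text \<open>Multiplying by the last factor of the denominator gives a recursion that determines
  coefficient \<open>Suc n\<close> from coefficients \<open>n\<close>.\<close>

lemma mak_series_Suc:
  "mak_series x y t u (Suc k) = fps_X * (fps_const (pq_int (Suc k) x y) * mak_series x y t u (Suc k) +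
     fps_const (pq_int (Suc k) (t * x) (u * y)) * mak_series x y t u k)"
proof -
  define P where "P = (\<Prod>i=1..k. 1 - fps_X * fps_const (pq_int i x y))"
  define c where "c = 1 - fps_X * fps_const (pq_int (Suc k) x y)"
  have P0: "fps_nth P 0 = 1" unfolding P_def by (rule fps_nth_0_prod_one_minus)
  have c0: "fps_nth c 0 = 1" by (simp add: c_def)
  have inv: "inverse c * c = 1" using c0 by (intro inverse_mult_eq_1) simp
  let ?A = "fps_X ^ k * fps_const (pq_fact k (t * x) (u * y)) * inverse P"
  have k: "mak_series x y t u k = ?A"
    unfolding mak_series_def P_def[symmetric] using P0 by (simp add: fps_divide_unit)
  have "mak_series x y t u (Suc k) =
      fps_X ^ Suc k * fps_const (pq_fact k (t * x) (u * y) * pq_int (Suc k) (t * x) (u * y)) /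
        (P * c)"
    by (simp add: mak_series_def P_def c_def pq_fact_Suc)
  also have "\<dots> = fps_X * fps_const (pq_int (Suc k) (t * x) (u * y)) * ?A * inverse c"
    using P0 c0 by (simp add: fps_divide_unit fps_inverse_mult ac_simps flip: fps_const_mult)
  finally have "mak_series x y t u (Suc k) * c = fps_X * fps_const (pq_int (Suc k) (t * x) (u * y)) * ?A"
    using inv by (simp add: mult.assoc)
  thus ?thesis unfolding k by (simp add: c_def algebra_simps)
qed

text \<open>The dependence on \<open>m\<close> separates from that on \<open>n\<close>: growing
  scales row \<open>N\<close> of \<open>mak_coeff\<close> by its eigenvalue, opening passes to the
  next row, and the scalar recursion of \<open>mak_series\<close> remains.\<close>

lemma mak_total:
  "mak.total x y t u n N m = mak_coeff x y N m * fps_nth (mak_series x y t u N) n"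
proof (induction n arbitrary: N m)
  case 0
  show ?case
  proof (cases N)
    case 0
    thus ?thesis by (simp add: mak.total_0 mak_series_def pq_fact_def)
  next
    case (Suc M)
    have "fps_nth (mak_series x y t u (Suc M)) 0 = 0"
      by (subst mak_series_Suc) simp
    thus ?thesis using Suc by (simp add: mak.total_0)
  qed
next
  case (Suc n)
  show ?case
  proof (cases N)
    case 0
    thus ?thesis by (simp add: mak.total_Suc_0 mak_series_def pq_fact_def)
  next
    case N: (Suc M)
    let ?s = "\<lambda>N. fps_nth (mak_series x y t u N) n"
    have s: "fps_nth (mak_series x y t u (Suc M)) (Suc n) =
        pq_int (Suc M) x y * ?s (Suc M) + pq_int (Suc M) (t * x) (u * y) * ?s M"
      by (subst mak_series_Suc) simp
    have rec: "mak.total x y t u (Suc n) (Suc M) m =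
      x ^ (Suc M - Suc m) * pq_int (Suc m) x y * mak.total x y t u n (Suc M) (Suc m) +
      x ^ (Suc M - m) * pq_int m x y * mak.total x y t u n (Suc M) m +
      pq_int (Suc M) (t * x) (u * y) * (x ^ (M - m) * y ^ (M + m) * mak.total x y t u n M m +
        (if m = 0 then 0
         else x ^ (M - (m - 1)) * y ^ (M + (m - 1)) * mak.total x y t u n M (m - 1)))"
      by (rule mak.total_Suc[where H = "\<lambda>n N m. x ^ (N - m) * y ^ (N + m)"]) (rule prod_h_mak)
    have c: "mak_coeff x y (Suc M) m * ?s M = x ^ (M - m) * y ^ (M + m) * (mak_coeff x y M m * ?s M) +
        (if m = 0 then 0
         else x ^ (M - (m - 1)) * y ^ (M + (m - 1)) * (mak_coeff x y M (m - 1) * ?s M))"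
      by (simp add: algebra_simps)
    have "mak.total x y t u (Suc n) (Suc M) m =
      (x ^ (Suc M - Suc m) * pq_int (Suc m) x y * mak_coeff x y (Suc M) (Suc m) +
       x ^ (Suc M - m) * pq_int m x y * mak_coeff x y (Suc M) m) * ?s (Suc M) +
      pq_int (Suc M) (t * x) (u * y) * (mak_coeff x y (Suc M) m * ?s M)"
      unfolding rec Suc c by (simp only: distrib_right mult.assoc)
    also have "\<dots> = mak_coeff x y (Suc M) m * fps_nth (mak_series x y t u (Suc M)) (Suc n)"
      unfolding mak_coeff_eigen s by (simp only: algebra_simps)
    finally show ?thesis unfolding N .
  qed
qed

lemma phi_mak_eq:
  fixes x y t u :: "'a::field"
  shows "phi_mak k x y t u =
     fps_X ^ k * fps_const ((x * y) ^ (k choose 2) * pq_fact k (t * x) (u * y)) /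
     (\<Prod>i=1..k. 1 - fps_X * fps_const (pq_int i x y))"
proof -
  have "phi_mak k x y t u = fps_const ((x * y) ^ (k choose 2)) * mak_series x y t u k"
    by (rule fps_ext) (simp add: phi_mak_nth mak_total mak_coeff_0)
  thus ?thesis
    using fps_nth_0_prod_one_minus[of "\<lambda>i. pq_int i x y" k]
    by (simp add: mak_series_def fps_divide_unit ac_simps flip: fps_const_mult)
qed

section \<open>The generating function of lmak\<close>

context
  fixes z t u :: "'a::field" and k :: nat
begin

text \<open>
  The factor \<open>z\<close> to the power \<open>n * (k - N)\<close> absorbs the weight \<open>z ^ n\<close> that opening a block at time \<open>n\<close> costs,
  so that the transfer equations below have constant coefficients.
\<close>
definition lmak_series :: "nat \<Rightarrow> nat \<Rightarrow> 'a fps" where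
  "lmak_series N m = Abs_fps (\<lambda>n. z ^ (n * (k - N)) * lmak.total z t u n N m)"

lemma lmak_series_eq_0: "N < m \<Longrightarrow> lmak_series N m = 0"
  by (rule fps_ext) (simp add: lmak_series_def lmak.total_eq_0)

lemma lmak_series_0: "lmak_series 0 0 = 1"
proof (rule fps_ext)
  fix n
  show "fps_nth (lmak_series 0 0) n = fps_nth 1 n"
    by (cases n) (simp_all add: lmak_series_def lmak.total_0 lmak.total_Suc_0)
qed

text \<open>With \<open>j\<close> blocks still to come, the normalising exponent at time
  \<open>n + 1\<close> is \<open>(n + 1) * j\<close>. One \<open>z ^ j\<close> is pulled out; the
  opening weight \<open>z ^ n\<close> turns the remaining \<open>n * j\<close> into
  \<open>n * (j + 1)\<close>, the exponent for \<open>N\<close>.\<close>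

lemma lmak_series_Suc:
  assumes "k = Suc N + j"
  shows "lmak_series (Suc N) m = fps_X * fps_const (z ^ j) *
     (fps_const (pq_int (Suc m) z 1) * lmak_series (Suc N) (Suc m) +
      fps_const (pq_int m z 1) * lmak_series (Suc N) m +
      fps_const (pq_int (Suc N) (t * z) u) *
        (lmak_series N m + (if m = 0 then 0 else lmak_series N (m - 1))))"
    (is "_ = fps_X * _ * ?R")
proof (rule fps_ext)
  fix n
  show "fps_nth (lmak_series (Suc N) m) n = fps_nth (fps_X * fps_const (z ^ j) * ?R) n"
  proof (cases n)
    case 0
    thus ?thesis by (simp add: lmak_series_def lmak.total_0)
  next
    case (Suc n')
    have e: "k - Suc N = j" "k - N = Suc j" using assms by auto
    have "lmak.total z t u (Suc n') (Suc N) m =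
       1 ^ (Suc N - Suc m) * pq_int (Suc m) z 1 * lmak.total z t u n' (Suc N) (Suc m) +
       1 ^ (Suc N - m) * pq_int m z 1 * lmak.total z t u n' (Suc N) m +
       pq_int (Suc N) (t * z) (u * 1) * (z ^ n' * lmak.total z t u n' N m +
         (if m = 0 then 0 else z ^ n' * lmak.total z t u n' N (m - 1)))"
      by (rule lmak.total_Suc[where H = "\<lambda>n N m. z ^ n"]) (rule prod_h_lmak)
    note T = this[unfolded power_one mult_1_left mult_1_right]
    show ?thesis unfolding Suc
      by (simp add: lmak_series_def mult.assoc e T) (simp add: algebra_simps power_add)
  qed
qed

section \<open>Functionals dual to the transfer equations\<close>

definition pole :: "nat \<Rightarrow> 'a fps" where
  "pole i = fps_X * fps_const (pq_int i z 1)"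

definition geom :: "nat \<Rightarrow> 'a fps" where
  "geom i = inverse (1 - pole i)"

lemma geom_eq: "1 + pole i * geom i = geom i"
proof -
  have "geom i * (1 - pole i) = 1"
    unfolding geom_def by (intro inverse_mult_eq_1) (simp add: pole_def)
  thus ?thesis by (simp add: algebra_simps)
qed

text \<open>
  \<open>source j\<close> and \<open>resolvent j\<close> are linear functionals on polynomials in \<open>w\<close>, given by their values at \<open>w ^ m\<close>:
  starting from evaluation at \<open>w = 0\<close>, they arise by composing backwards, alternately, with the resolvent
  \<open>(1 - a z\<^sup>j T)\<^sup>-\<^sup>1\<close> of the operator \<open>T\<close> adding an element to an active block, and with multiplication by \<open>1 + w\<close>
  (opening a block).
\<close>
definition resolvent :: "nat \<Rightarrow> nat \<Rightarrow> 'a fps" where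
  "resolvent j m = (\<Prod>i<j. geom (Suc i)) * (\<Prod>i<m. pole (Suc (j + i)) * geom (Suc (j + i)))"

fun source :: "nat \<Rightarrow> nat \<Rightarrow> 'a fps" where
  "source 0 m = of_bool (m = 0)"
| "source (Suc j) m = resolvent j m + resolvent j (Suc m)"

text \<open>Since \<open>1 + e / (1 - e) = 1 / (1 - e)\<close>, composition with multiplication by
  \<open>1 + w\<close> keeps the product form.\<close>

lemma source_Suc: "source (Suc j) m = resolvent j m * geom (Suc (j + m))"
proof -
  have "source (Suc j) m = resolvent j m * (1 + pole (Suc (j + m)) * geom (Suc (j + m)))"
    by (simp add: resolvent_def algebra_simps)
  thus ?thesis by (simp only: geom_eq)
qed

text \<open>The factor at \<open>i = 0\<close> is broken up: its \<open>geom\<close> joins the first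
  product, its \<open>pole\<close> stays in front.\<close>

lemma resolvent_Suc_left:
  "resolvent j (Suc m) = pole (Suc j) * resolvent (Suc j) m"
  unfolding resolvent_def prod.lessThan_Suc_shift[of _ m] by (simp add: ac_simps)

lemma resolvent_Suc_right:
  "resolvent j (Suc m) = resolvent j m * (pole (Suc (j + m)) * geom (Suc (j + m)))"
  by (simp add: resolvent_def ac_simps)

lemma source_0: "source j 0 = (\<Prod>i<j. geom (Suc i))"
proof (cases j)
  case (Suc i)
  thus ?thesis by (simp only: source_Suc) (simp add: resolvent_def)
qed simp

text \<open>The equation \<open>R = S + a z^j R T\<close> of the resolvent, evaluated at
  \<open>w ^ m\<close>, where \<open>T\<close> sends \<open>w ^ m\<close> to
  \<open>[m] (w ^ m + w ^ (m - 1))\<close>. At \<open>m = 0\<close> the factor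
  \<open>[0] = 0\<close> makes the truncated \<open>m - 1\<close> harmless.\<close>

lemma resolvent_eq:
  "resolvent j m = source j m +
     fps_X * fps_const (z ^ j) * fps_const (pq_int m z 1) * (resolvent j m + resolvent j (m - 1))"
proof (cases m)
  case 0
  thus ?thesis unfolding 0 source_0 by (simp add: resolvent_def)
next
  case (Suc m')
  let ?K = "resolvent j m'" and ?g = "geom (Suc (j + m'))" and ?e = "pole (Suc (j + m'))"
  let ?f = "fps_X * fps_const (z ^ j) * fps_const (pq_int m z 1)"
  \<comment> \<open>For \<open>j = 0\<close> both sides vanish, because \<open>m > 0\<close> and
    \<open>pole 0 = 0\<close>.\<close>
  have s: "source j m = ?K * pole j * ?g"
  proof (cases j)
    case 0
    thus ?thesis using Suc by (simp add: pole_def)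
  next
    case j: (Suc i)
    show ?thesis unfolding Suc j source_Suc resolvent_Suc_left by (simp add: ac_simps)
  qed
  \<comment> \<open>This splitting of the last pole separates the source term from the operator
    term.\<close>
  have e: "?e = pole j + ?f"
  proof -
    have "pq_int (m + j) z 1 = pq_int j z 1 + z ^ j * pq_int m z 1"
      using pq_int_add[of m j z 1] by simp
    thus ?thesis using Suc by (simp add: pole_def algebra_simps flip: fps_const_add fps_const_mult)
  qed
  have "?f * (resolvent j m + resolvent j (m - 1)) = ?f * (?K * (1 + ?e * ?g))"
    using Suc by (simp only: resolvent_Suc_right) (simp add: algebra_simps)
  also have "\<dots> = ?f * (?K * ?g)" by (simp only: geom_eq)
  finally show ?thesis
    using s e Suc by (simp only: resolvent_Suc_right) (simp add: algebra_simps)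
qed

text \<open>Pair the transfer equation with \<open>resolvent j\<close>. By
  \<open>resolvent_eq\<close> the terms staying at \<open>Suc N\<close> blocks reduce the left side
  to \<open>source j\<close>; the opening terms carry the factor \<open>1 + w\<close>, which turns
  the resolvent into \<open>source (Suc j)\<close>.\<close>

lemma sum_source_lmak_series:
  assumes "k = Suc N + j"
  shows "(\<Sum>m\<le>Suc N. source j m * lmak_series (Suc N) m) =
    fps_X * fps_const (z ^ j * pq_int (Suc N) (t * z) u) *
      (\<Sum>m\<le>N. source (Suc j) m * lmak_series N m)"
proof -
  let ?F = "lmak_series (Suc N)" and ?G = "lmak_series N" and ?r = "resolvent j"
  let ?b = "fps_X * fps_const (z ^ j)" and ?c = "fps_const (pq_int (Suc N) (t * z) u)"
  let ?q = "\<lambda>m. fps_const (pq_int m z 1)"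
  let ?X = "\<Sum>m\<le>Suc N. ?q m * (?r m + ?r (m - 1)) * ?F m"
  \<comment> \<open>Index shift without boundary terms: \<open>[0] = 0\<close> at the bottom, and no
    state has more active blocks than blocks at the top.\<close>
  have shift: "(\<Sum>m\<le>Suc N. ?r m * (?q (Suc m) * ?F (Suc m))) = (\<Sum>m\<le>Suc N. ?q m * ?r (m - 1) * ?F m)"
  proof -
    have "(\<Sum>m\<le>Suc N. ?q m * ?r (m - 1) * ?F m) = (\<Sum>m\<le>N. ?r m * (?q (Suc m) * ?F (Suc m)))"
      unfolding sum.atMost_Suc_shift by (simp add: ac_simps)
    thus ?thesis by (simp add: lmak_series_eq_0)
  qed
  \<comment> \<open>Multiplication by \<open>1 + w\<close> is moved from the series to the
    functional.\<close>
  have G: "(\<Sum>m\<le>Suc N. ?r m * (?G m + (if m = 0 then 0 else ?G (m - 1)))) =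
      (\<Sum>m\<le>N. source (Suc j) m * ?G m)"
  proof -
    have "(\<Sum>m\<le>Suc N. ?r m * (?G m + (if m = 0 then 0 else ?G (m - 1)))) =
        (\<Sum>m\<le>Suc N. ?r m * ?G m) + (\<Sum>m\<le>Suc N. ?r m * (if m = 0 then 0 else ?G (m - 1)))"
      by (simp only: distrib_left sum.distrib)
    also have "(\<Sum>m\<le>Suc N. ?r m * ?G m) = (\<Sum>m\<le>N. ?r m * ?G m)"
      by (simp add: lmak_series_eq_0)
    also have "(\<Sum>m\<le>Suc N. ?r m * (if m = 0 then 0 else ?G (m - 1))) = (\<Sum>m\<le>N. ?r (Suc m) * ?G m)"
      unfolding sum.atMost_Suc_shift by simp
    finally show ?thesis by (simp add: sum.distrib[symmetric] distrib_right)
  qed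
  have "(\<Sum>m\<le>Suc N. ?r m * ?F m) = (\<Sum>m\<le>Suc N. source j m * ?F m) + ?b * ?X"
  proof -
    have "?r m * ?F m = source j m * ?F m + ?b * (?q m * (?r m + ?r (m - 1)) * ?F m)" for m
      by (subst resolvent_eq) (simp add: algebra_simps flip: fps_const_mult)
    thus ?thesis by (simp only: sum.distrib sum_distrib_left)
  qed
  moreover have "(\<Sum>m\<le>Suc N. ?r m * ?F m) = ?b * ?X + ?b * ?c * (\<Sum>m\<le>N. source (Suc j) m * ?G m)"
  proof -
    have "?r m * ?F m = ?b * (?r m * (?q (Suc m) * ?F (Suc m))) + ?b * (?q m * ?r m * ?F m) +
        ?b * ?c * (?r m * (?G m + (if m = 0 then 0 else ?G (m - 1))))" for m
      by (subst lmak_series_Suc[OF assms]) (simp only: algebra_simps)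
    hence "(\<Sum>m\<le>Suc N. ?r m * ?F m) = ?b * (\<Sum>m\<le>Suc N. ?r m * (?q (Suc m) * ?F (Suc m))) +
        ?b * (\<Sum>m\<le>Suc N. ?q m * ?r m * ?F m) +
        ?b * ?c * (\<Sum>m\<le>Suc N. ?r m * (?G m + (if m = 0 then 0 else ?G (m - 1))))"
      by (simp only: sum.distrib sum_distrib_left)
    also have "?b * (\<Sum>m\<le>Suc N. ?r m * (?q (Suc m) * ?F (Suc m))) +
        ?b * (\<Sum>m\<le>Suc N. ?q m * ?r m * ?F m) = ?b * ?X"
      unfolding shift by (simp only: distrib_left distrib_right sum.distrib add.commute)
    finally show ?thesis unfolding G .
  qed
  ultimately have "(\<Sum>m\<le>Suc N. source j m * ?F m) = ?b * ?c * (\<Sum>m\<le>N. source (Suc j) m * ?G m)"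
    by simp
  thus ?thesis by (simp add: mult.assoc flip: fps_const_mult)
qed

text \<open>Each step lowers \<open>N\<close>, raises \<open>j\<close> and releases a scalar. At
  \<open>N = 0\<close> only the state without blocks is left, paired with
  \<open>source k 0\<close>.\<close>

lemma sum_source_closed:
  assumes "k = N + j"
  shows "(\<Sum>m\<le>N. source j m * lmak_series N m) =
    fps_X ^ N * fps_const (z ^ (\<Sum>i\<in>{j..<k}. i) * pq_fact N (t * z) u) * source k 0"
  using assms
proof (induction N arbitrary: j)
  case 0
  hence j: "j = k" by simp
  show ?case unfolding j by (simp add: lmak_series_0 pq_fact_def)
next
  case (Suc N)
  have "{j..<k} = insert j {Suc j..<k}" using Suc.prems by auto
  hence "(\<Sum>i\<in>{j..<k}. i) = j + (\<Sum>i\<in>{Suc j..<k}. i)" by simp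
  hence e: "z ^ (\<Sum>i\<in>{j..<k}. i) = z ^ j * z ^ (\<Sum>i\<in>{Suc j..<k}. i)"
    by (simp only: power_add)
  have "(\<Sum>m\<le>N. source (Suc j) m * lmak_series N m) =
      fps_X ^ N * fps_const (z ^ (\<Sum>i\<in>{Suc j..<k}. i) * pq_fact N (t * z) u) * source k 0"
    using Suc.prems by (intro Suc.IH) simp
  thus ?case
    unfolding sum_source_lmak_series[OF Suc.prems] e pq_fact_Suc
    by (simp only: power_Suc fps_const_mult[symmetric] ac_simps)
qed

text \<open>At \<open>N = k\<close> the normalising power of \<open>z\<close> is trivial and
  \<open>source 0\<close> is evaluation at \<open>w = 0\<close>, so the series is the pairing at
  \<open>j = 0\<close>; \<open>source k 0\<close> supplies the denominator.\<close>

lemma phi_lmak_eq: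
  "phi_lmak k z t u = fps_X ^ k * fps_const (z ^ (k choose 2) * pq_fact k (t * z) u) /
     (\<Prod>i=1..k. 1 - fps_X * fps_const (q_int i z))"
proof -
  have "phi_lmak k z t u = lmak_series k 0"
    by (rule fps_ext) (simp add: phi_lmak_nth lmak_series_def)
  also have "\<dots> = (\<Sum>m\<le>k. source 0 m * lmak_series k m)"
  proof -
    have "(\<Sum>m\<le>k. source 0 m * lmak_series k m) = (\<Sum>m\<in>{0}. source 0 m * lmak_series k m)"
      by (rule sum.mono_neutral_right) auto
    thus ?thesis by simp
  qed
  also have "\<dots> = fps_X ^ k * fps_const (z ^ (\<Sum>i\<in>{0..<k}. i) * pq_fact k (t * z) u) * source k 0"
    by (rule sum_source_closed) simp
  also have "(\<Sum>i\<in>{0..<k}. i) = k choose 2"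
    unfolding choose_two_eq_sum by (simp add: atLeast0LessThan)
  also have "source k 0 = inverse (\<Prod>i=1..k. 1 - fps_X * fps_const (q_int i z))"
  proof -
    have "source k 0 = (\<Prod>i=1..k. geom i)"
      unfolding source_0 by (rule prod.reindex_bij_witness[of _ "\<lambda>i. i - 1" Suc]) auto
    also have "\<dots> = inverse (\<Prod>i=1..k. 1 - pole i)"
      by (induction k) (auto simp: geom_def fps_inverse_mult)
    finally show ?thesis by (simp add: pole_def q_int_def pq_int_commute[of _ 1])
  qed
  finally show ?thesis
    using fps_nth_0_prod_one_minus[of "\<lambda>i. q_int i z" k] by (simp add: fps_divide_unit)
qed

end

theorem theorem2p3:
  fixes k :: nat and x y z t u :: "'a::field"
  shows "phi_mak k x y t u =
           fps_X ^ k * fps_const ((x * y) ^ (k choose 2) * pq_fact k (t * x) (u * y)) /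
           (\<Prod>i=1..k. 1 - fps_X * fps_const (pq_int i x y))
       \<and> phi_lmak k z t u =
           fps_X ^ k * fps_const (z ^ (k choose 2) * pq_fact k (t * z) u) /
           (\<Prod>i=1..k. 1 - fps_X * fps_const (q_int i z))"
  using phi_mak_eq phi_lmak_eq by blast

end
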